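(* For every $k\in\{2,3,4,\dots\}$, $\mathbb A(k)$ is completely isomorphic to $\mathbb A(\infty)$.
   Context: For $k\in\{1,2,\dots\}\cup\{\infty\}$, let $P_k$ be the free semigroup of words in positive powers of $k$ letters $e_1,e_2,\dots$ (including the empty word $\emptyset$), and $\ell_2(P_k)$ (the full Fock space) the Hilbert space with orthonormal basis $\{\delta_x:x\in P_k\}$. For $x\in P_k$ let $L_x\delta_y=\delta_{xy}$. $\mathbb A(k)$ is the norm closure of $\mathrm{span}\{L_x:x\in P_k\}$ in $B(\ell_2(P_k))$. Completely isomorphic means related by a linear bijection which is completely bounded with completely bounded inverse. *)

theory Defs
  imports "HOL-Analysis.Analysis" "HOL-Library.Extended_Nat"
begin

text \<open>Words in the free semigroup P_k: lists of letters; letter i stands for e_(i+1).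
  For k = \<infinity> all natural numbers are allowed as letters.\<close>
definition words :: "enat \<Rightarrow> nat list set" where
  "words k = {w. \<forall>i\<in>set w. enat i < k}"

type_synonym vec = "nat list \<Rightarrow> complex"
type_synonym oper = "vec \<Rightarrow> vec"

definition l2 :: "enat \<Rightarrow> vec set" where
  "l2 k = {f. (\<forall>w. w \<notin> words k \<longrightarrow> f w = 0) \<and>
               (\<lambda>w. (cmod (f w))\<^sup>2) summable_on UNIV}"

definition l2norm :: "vec \<Rightarrow> real" where
  "l2norm f = sqrt (infsum (\<lambda>w. (cmod (f w))\<^sup>2) UNIV)"

text \<open>Left creation operator L_x: (L_x f)(w) = f(y) if w = x y, else 0; so L_x delta_y = delta_(xy).\<close>
definition Lop :: "nat list \<Rightarrow> oper" where
  "Lop x f w = (if take (length x) w = x then f (drop (length x) w) else 0)"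

definition op_bound :: "enat \<Rightarrow> oper \<Rightarrow> real \<Rightarrow> bool" where
  "op_bound k T c \<longleftrightarrow> (\<forall>f\<in>l2 k. T f \<in> l2 k \<and> l2norm (T f) \<le> c * l2norm f)"

definition Lspan :: "enat \<Rightarrow> oper set" where
  "Lspan k = {(\<lambda>f w. \<Sum>x\<in>F. c x * Lop x f w) | F c. finite F \<and> F \<subseteq> words k}"

text \<open>The algebra A(k): norm closure of span of L_x in B(l2(P_k)). Operators are
  represented canonically as functions vanishing outside l2(P_k).\<close>
definition Alg :: "enat \<Rightarrow> oper set" where
  "Alg k = {T. (\<forall>f. f \<notin> l2 k \<longrightarrow> T f = (\<lambda>w. 0)) \<and>
               (\<forall>\<epsilon>>0. \<exists>S\<in>Lspan k. op_bound k (\<lambda>f w. T f w - S f w) \<epsilon>)}"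

definition mat_bound :: "enat \<Rightarrow> nat \<Rightarrow> (nat \<Rightarrow> nat \<Rightarrow> oper) \<Rightarrow> real \<Rightarrow> bool" where
  "mat_bound k n T c \<longleftrightarrow>
     (\<forall>f. (\<forall>j<n. f j \<in> l2 k) \<longrightarrow>
        (\<Sum>i<n. (l2norm (\<lambda>w. \<Sum>j<n. T i j (f j) w))\<^sup>2) \<le> c\<^sup>2 * (\<Sum>j<n. (l2norm (f j))\<^sup>2))"

definition lin_on :: "enat \<Rightarrow> (oper \<Rightarrow> oper) \<Rightarrow> bool" where
  "lin_on k \<Phi> \<longleftrightarrow> (\<forall>S\<in>Alg k. \<forall>T\<in>Alg k. \<forall>a::complex.
      \<Phi> (\<lambda>f w. a * S f w + T f w) = (\<lambda>f w. a * \<Phi> S f w + \<Phi> T f w))"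

definition cb_on :: "enat \<Rightarrow> enat \<Rightarrow> (oper \<Rightarrow> oper) \<Rightarrow> bool" where
  "cb_on k k' \<Phi> \<longleftrightarrow> (\<exists>C\<ge>0. \<forall>n T c. (\<forall>i<n. \<forall>j<n. T i j \<in> Alg k) \<longrightarrow> c \<ge> 0 \<longrightarrow>
      mat_bound k n T c \<longrightarrow> mat_bound k' n (\<lambda>i j. \<Phi> (T i j)) (C * c))"

definition completely_isomorphic :: "enat \<Rightarrow> enat \<Rightarrow> bool" where
  "completely_isomorphic k k' \<longleftrightarrow> (\<exists>\<Phi> \<Psi>.
      \<Phi> ` Alg k \<subseteq> Alg k' \<and> \<Psi> ` Alg k' \<subseteq> Alg k \<and>
      (\<forall>T\<in>Alg k. \<Psi> (\<Phi> T) = T) \<and> (\<forall>S\<in>Alg k'. \<Phi> (\<Psi> S) = S) \<and>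
      lin_on k \<Phi> \<and> cb_on k k' \<Phi> \<and> cb_on k' k \<Psi>)"

end

theory Submission
  imports Defs
begin

(* An operator in A(k) is left convolution by its symbol, the vector T delta_[], so a linear
   bijection can be sought among those permuting words. Relabelling first letters of nonempty
   words, cutting down to the words i v with v in k letters, and prepending or removing a letter
   are completely bounded, because creation operators have orthogonal ranges (column structure).
   Moreover A(infinity) is completely complemented in A(k): the words 0 1^i 0 form a bifix code,
   the prefix property giving the embedding and the suffix property the projection. Since A(k) is
   likewise complemented in A(infinity), and A(infinity) absorbs countable column sums of copies
   of A(k), Pelczynski's decomposition applies; here it is realised by one explicit bijection of
   words assembled from finitely many of these maps. *)

section \<open>Symbols and matrix bounds\<close>

text \<open>Write A_0 for the symbols vanishing at the empty word. The words i v with v a nonempty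
  word in k letters form countably many copies of A_0(k) inside A_0(infinity), so a shift of i
  splits one off: A_0(infinity) = A_0(k) + A_0(infinity). The code gives A_0(k) = W + A_0(infinity),
  where W consists of the symbols off \<open>range \<theta>\<close>, and parity of the first letter
  gives A_0(infinity) + A_0(infinity) = A_0(infinity). Hence A_0(infinity) = W + A_0(infinity) +
  A_0(infinity) = W + A_0(infinity) = A_0(k). Each identification moves words to words, so
  polynomials go to polynomials in both directions, and the inverse laws reduce to identities
  between words. The obstacle is the norm: a permutation of words has in general no reason to be
  bounded. Both directions are therefore rewritten as sums and composites of a few maps, each a
  compression or an amplification for which one transfer lemma gives the matrix bounds.\<close>

primrec conv :: "vec \<Rightarrow> vec \<Rightarrow> nat list \<Rightarrow> complex" where
  "conv a f [] = a [] * f []"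
| "conv a f (i # x) = a [] * f (i # x) + conv (\<lambda>w. a (i # w)) f x"

definition splits :: "nat list \<Rightarrow> (nat list \<times> nat list) set" where
  "splits x = {(w, z). w @ z = x}"

lemma splits_Nil: "splits [] = {([], [])}"
  by (auto simp: splits_def)

lemma splits_Cons:
  "splits (i # x) = insert ([], i # x) ((\<lambda>(w, z). (i # w, z)) ` splits x)"
proof (intro set_eqI)
  fix p :: "nat list \<times> nat list"
  obtain w z where p: "p = (w, z)" by fastforce
  show "p \<in> splits (i # x) \<longleftrightarrow> p \<in> insert ([], i # x) ((\<lambda>(w, z). (i # w, z)) ` splits x)"
    unfolding p splits_def by (cases w) (auto simp: image_iff)
qed

lemma finite_splits: "finite (splits x)"
  by (induction x) (auto simp: splits_Nil splits_Cons)

text \<open>The recursion in \<open>conv\<close> suits maps acting on the first letter; this sum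
  over factorizations gives linearity and can be reindexed along the code.\<close>

lemma conv_splits: "conv a f x = (\<Sum>(w, z)\<in>splits x. a w * f z)"
proof (induction x arbitrary: a)
  case Nil
  then show ?case by (simp add: splits_Nil)
next
  case (Cons i x)
  have "(\<Sum>(w, z)\<in>(\<lambda>(w, z). (i # w, z)) ` splits x. a w * f z)
      = (\<Sum>(w, z)\<in>splits x. a (i # w) * f z)"
    by (subst sum.reindex) (auto simp: inj_on_def case_prod_unfold)
  moreover have "([], i # x) \<notin> (\<lambda>(w, z). (i # w, z)) ` splits x" by auto
  ultimately show ?case
    by (simp add: splits_Cons finite_splits Cons.IH)
qed

lemma conv_add: "conv (\<lambda>w. a w + b w) f x = conv a f x + conv b f x"
  by (simp add: conv_splits case_prod_unfold sum.distrib distrib_right)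

lemma conv_diff: "conv (\<lambda>w. a w - b w) f x = conv a f x - conv b f x"
  by (simp add: conv_splits case_prod_unfold sum_subtractf left_diff_distrib)

lemma conv_scale: "conv (\<lambda>w. c * a w) f x = c * conv a f x"
  by (simp add: conv_splits case_prod_unfold sum_distrib_left mult.assoc)

lemma conv_zero: "conv (\<lambda>w. 0) f x = 0"
  by (simp add: conv_splits)

text \<open>Testing on finite sets only avoids every summability condition; for symbols of operators in
  the algebras this is the same as \<^const>\<open>mat_bound\<close> (see \<open>mat_bound_iff_sym_bound\<close> below).\<close>
definition sym_bound :: "nat list set \<Rightarrow> nat \<Rightarrow> (nat \<Rightarrow> nat \<Rightarrow> vec) \<Rightarrow> real \<Rightarrow> bool" where
  "sym_bound U n a c \<longleftrightarrow>
     (\<forall>G H f. finite G \<and> finite H \<and> G \<subseteq> U \<and> H \<subseteq> U \<and> (\<forall>j<n. \<forall>w. w \<notin> H \<longrightarrow> f j w = 0) \<longrightarrow>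
        (\<Sum>i<n. \<Sum>x\<in>G. (cmod (\<Sum>j<n. conv (a i j) (f j) x))\<^sup>2)
          \<le> c\<^sup>2 * (\<Sum>j<n. \<Sum>y\<in>H. (cmod (f j y))\<^sup>2))"

lemma sym_boundD:
  assumes "sym_bound U n a c" "finite G" "finite H" "G \<subseteq> U" "H \<subseteq> U"
    and "\<And>j w. j < n \<Longrightarrow> w \<notin> H \<Longrightarrow> f j w = 0"
  shows "(\<Sum>i<n. \<Sum>x\<in>G. (cmod (\<Sum>j<n. conv (a i j) (f j) x))\<^sup>2)
          \<le> c\<^sup>2 * (\<Sum>j<n. \<Sum>y\<in>H. (cmod (f j y))\<^sup>2)"
proof -
  have "finite G \<and> finite H \<and> G \<subseteq> U \<and> H \<subseteq> U \<and> (\<forall>j<n. \<forall>w. w \<notin> H \<longrightarrow> f j w = 0)"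
    by (intro conjI allI impI) (fact assms)+
  with assms(1)[unfolded sym_bound_def, THEN spec, THEN spec, THEN spec, of G H f] show ?thesis
    by (rule mp)
qed

lemma sym_boundI:
  assumes "\<And>G H f. finite G \<Longrightarrow> finite H \<Longrightarrow> G \<subseteq> U \<Longrightarrow> H \<subseteq> U \<Longrightarrow>
     (\<And>j w. j < n \<Longrightarrow> w \<notin> H \<Longrightarrow> f j w = 0) \<Longrightarrow>
        (\<Sum>i<n. \<Sum>x\<in>G. (cmod (\<Sum>j<n. conv (a i j) (f j) x))\<^sup>2)
          \<le> c\<^sup>2 * (\<Sum>j<n. \<Sum>y\<in>H. (cmod (f j y))\<^sup>2)"
  shows "sym_bound U n a c"
  unfolding sym_bound_def
proof (intro allI impI, elim conjE)
  fix G H and f :: "nat \<Rightarrow> vec"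
  assume *: "finite G" "finite H" "G \<subseteq> U" "H \<subseteq> U" "\<forall>j<n. \<forall>w. w \<notin> H \<longrightarrow> f j w = 0"
  show "(\<Sum>i<n. \<Sum>x\<in>G. (cmod (\<Sum>j<n. conv (a i j) (f j) x))\<^sup>2)
          \<le> c\<^sup>2 * (\<Sum>j<n. \<Sum>y\<in>H. (cmod (f j y))\<^sup>2)"
    by (rule assms[OF *(1-4)]) (use *(5) in blast)
qed

lemma sym_bound_mono:
  assumes "sym_bound U n a c" "0 \<le> c" "c \<le> d"
  shows "sym_bound U n a d"
proof (rule sym_boundI)
  fix G H and f :: "nat \<Rightarrow> vec"
  assume *: "finite G" "finite H" "G \<subseteq> U" "H \<subseteq> U"
    "\<And>j w. j < n \<Longrightarrow> w \<notin> H \<Longrightarrow> f j w = 0"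
  note sym_boundD[OF assms(1) *]
  also have "c\<^sup>2 * (\<Sum>j<n. \<Sum>y\<in>H. (cmod (f j y))\<^sup>2) \<le> d\<^sup>2 * (\<Sum>j<n. \<Sum>y\<in>H. (cmod (f j y))\<^sup>2)"
    using assms(2,3) by (intro mult_right_mono power_mono sum_nonneg) auto
  finally show "(\<Sum>i<n. \<Sum>x\<in>G. (cmod (\<Sum>j<n. conv (a i j) (f j) x))\<^sup>2)
          \<le> d\<^sup>2 * (\<Sum>j<n. \<Sum>y\<in>H. (cmod (f j y))\<^sup>2)" .
qed

lemma sym_bound_subset:
  assumes "sym_bound U n a c" "V \<subseteq> U"
  shows "sym_bound V n a c"
  by (rule sym_boundI, rule sym_boundD[OF assms(1)]) (use assms(2) in auto)

lemma sym_bound_cong: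
  assumes "sym_bound U n a c" "\<And>i j. i < n \<Longrightarrow> j < n \<Longrightarrow> a i j = b i j"
  shows "sym_bound U n b c"
proof (rule sym_boundI)
  fix G H and f :: "nat \<Rightarrow> vec"
  assume "finite G" "finite H" "G \<subseteq> U" "H \<subseteq> U"
    "\<And>j w. j < n \<Longrightarrow> w \<notin> H \<Longrightarrow> f j w = 0"
  from sym_boundD[OF assms(1) this]
  show "(\<Sum>i<n. \<Sum>x\<in>G. (cmod (\<Sum>j<n. conv (b i j) (f j) x))\<^sup>2)
          \<le> c\<^sup>2 * (\<Sum>j<n. \<Sum>y\<in>H. (cmod (f j y))\<^sup>2)"
    by (simp add: assms(2) cong: sum.cong_simp)
qed

lemma sym_bound_minus:
  assumes "sym_bound U n a c"
  shows "sym_bound U n (\<lambda>i j w. - a i j w) c"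
proof (rule sym_boundI)
  fix G H and f :: "nat \<Rightarrow> vec"
  assume "finite G" "finite H" "G \<subseteq> U" "H \<subseteq> U"
    "\<And>j w. j < n \<Longrightarrow> w \<notin> H \<Longrightarrow> f j w = 0"
  note * = sym_boundD[OF assms this]
  have m: "conv (\<lambda>w. - a i j w) f x = - conv (a i j) f x" for i j f x
    using conv_scale[of "-1" "a i j" f x] by simp
  show "(\<Sum>i<n. \<Sum>x\<in>G. (cmod (\<Sum>j<n. conv (\<lambda>w. - a i j w) (f j) x))\<^sup>2)
          \<le> c\<^sup>2 * (\<Sum>j<n. \<Sum>y\<in>H. (cmod (f j y))\<^sup>2)"
    unfolding m sum_negf norm_minus_cancel by (rule *)
qed

text \<open>Minkowski's inequality in the finite-dimensional l2 space indexed by pairs of a row and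
  a word of \<open>G\<close>.\<close>

lemma sym_bound_add:
  assumes a: "sym_bound U n a c" and b: "sym_bound U n b d" and cd: "0 \<le> c" "0 \<le> d"
  shows "sym_bound U n (\<lambda>i j w. a i j w + b i j w) (c + d)"
proof (rule sym_boundI)
  fix G H and f :: "nat \<Rightarrow> vec"
  assume *: "finite G" "finite H" "G \<subseteq> U" "H \<subseteq> U" "\<And>j w. j < n \<Longrightarrow> w \<notin> H \<Longrightarrow> f j w = 0"
  define N where "N = (\<Sum>j<n. \<Sum>y\<in>H. (cmod (f j y))\<^sup>2)"
  define A where "A = (\<lambda>(i, x). cmod (\<Sum>j<n. conv (a i j) (f j) x))"
  define B where "B = (\<lambda>(i, x). cmod (\<Sum>j<n. conv (b i j) (f j) x))"
  define I where "I = {..<n} \<times> G"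
  have N: "N \<ge> 0" unfolding N_def by (intro sum_nonneg) auto
  have "L2_set A I \<le> sqrt (c\<^sup>2 * N)"
    unfolding L2_set_def I_def A_def N_def using sym_boundD[OF a *]
    by (simp add: sum.cartesian_product case_prod_unfold)
  then have A: "L2_set A I \<le> c * sqrt N" using cd by (simp add: real_sqrt_mult)
  have "L2_set B I \<le> sqrt (d\<^sup>2 * N)"
    unfolding L2_set_def I_def B_def N_def using sym_boundD[OF b *]
    by (simp add: sum.cartesian_product case_prod_unfold)
  then have B: "L2_set B I \<le> d * sqrt N" using cd by (simp add: real_sqrt_mult)
  have "L2_set (\<lambda>p. A p + B p) I \<le> (c + d) * sqrt N"
    using L2_set_triangle_ineq[of A B I] A B by (simp add: distrib_right)
  then have "(L2_set (\<lambda>p. A p + B p) I)\<^sup>2 \<le> ((c + d) * sqrt N)\<^sup>2"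
    by (intro power_mono) auto
  then have S: "(\<Sum>p\<in>I. (A p + B p)\<^sup>2) \<le> (c + d)\<^sup>2 * N"
    using N by (simp add: L2_set_def sum_nonneg power_mult_distrib)
  have "(\<Sum>i<n. \<Sum>x\<in>G. (cmod (\<Sum>j<n. conv (\<lambda>w. a i j w + b i j w) (f j) x))\<^sup>2)
      = (\<Sum>(i, x)\<in>I. (cmod (\<Sum>j<n. conv (\<lambda>w. a i j w + b i j w) (f j) x))\<^sup>2)"
    by (simp add: I_def sum.cartesian_product)
  also have "\<dots> \<le> (\<Sum>p\<in>I. (A p + B p)\<^sup>2)"
    by (intro sum_mono)
      (auto simp: A_def B_def conv_add sum.distrib intro!: power_mono norm_triangle_ineq)
  also note S
  finally show "(\<Sum>i<n. \<Sum>x\<in>G. (cmod (\<Sum>j<n. conv (\<lambda>w. a i j w + b i j w) (f j) x))\<^sup>2)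
     \<le> (c + d)\<^sup>2 * (\<Sum>j<n. \<Sum>y\<in>H. (cmod (f j y))\<^sup>2)" by (simp add: N_def)
qed

text \<open>Composition with the partial map \<open>m r\<close>, extended by zero. If
  \<open>m r\<close> is injective, this is a partial isometry on vectors.\<close>

definition pull :: "('r \<Rightarrow> nat list \<Rightarrow> nat list option) \<Rightarrow> 'r \<Rightarrow> vec \<Rightarrow> vec" where
  "pull m r f y = (case m r y of None \<Rightarrow> 0 | Some z \<Rightarrow> f z)"

text \<open>Spatial idea: up to partial isometries given by injections of words, the operator with symbol
  \<open>b\<close> is a direct sum of copies of the operator with symbol \<open>a\<close>, indexed by the values of \<open>r\<close>;
  \<open>m s\<close> places the domain of the copy \<open>s\<close> and \<open>q\<close> identifies its range.\<close>
lemma sym_bound_transfer: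
  fixes m :: "'r \<Rightarrow> nat list \<Rightarrow> nat list option"
  assumes a: "sym_bound U n a c"
    and inj: "inj_on (\<lambda>x. (r x, q x)) X"
    and q: "\<And>x. x \<in> X \<Longrightarrow> q x \<in> U"
    and zero: "\<And>i j f x. i < n \<Longrightarrow> j < n \<Longrightarrow> x \<notin> X \<Longrightarrow> conv (b i j) f x = 0"
    and eq: "\<And>i j f x. i < n \<Longrightarrow> j < n \<Longrightarrow> x \<in> X \<Longrightarrow>
          conv (b i j) f x = conv (a i j) (pull m (r x) f) (q x)"
    and mU: "\<And>s y z. m s y = Some z \<Longrightarrow> y \<in> U"
    and minj: "\<And>x y z x' y'. x \<in> X \<Longrightarrow> x' \<in> X \<Longrightarrow> m (r x) y = Some z \<Longrightarrow>
          m (r x') y' = Some z \<Longrightarrow> r x = r x' \<and> y = y'"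
  shows "sym_bound V n b c"
proof (rule sym_boundI)
  fix G H and f :: "nat \<Rightarrow> vec"
  assume *: "finite G" "finite H" "G \<subseteq> V" "H \<subseteq> V" "\<And>j w. j < n \<Longrightarrow> w \<notin> H \<Longrightarrow> f j w = 0"
  define G' where "G' = G \<inter> X"
  define R where "R = r ` G'"
  define Gr where "Gr = (\<lambda>s. {x \<in> G'. r x = s})"
  define Hr where "Hr = (\<lambda>s. {y. \<exists>z\<in>H. m s y = Some z})"
  have fin: "finite G'" "finite R" "\<And>s. finite (Gr s)"
    using * by (auto simp: G'_def R_def Gr_def)
  have RX: "\<exists>x\<in>X. s = r x" if "s \<in> R" for s using that by (auto simp: R_def G'_def)
  have mi: "s = s' \<and> y = y'" if mi: "s \<in> R" "s' \<in> R" "m s y = Some z" "m s' y' = Some z" for s s' y y' z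
  proof -
    obtain x x' where "x \<in> X" "s = r x" "x' \<in> X" "s' = r x'"
      using RX[OF mi(1)] RX[OF mi(2)] by auto
    then show ?thesis using minj[of x x' y z y'] mi(3,4) by simp
  qed
  have minj_on: "inj_on (\<lambda>(s, y). the (m s y)) (SIGMA s:R. Hr s)"
  proof (rule inj_onI, clarify)
    fix s y s' y'
    assume "s \<in> R" "y \<in> Hr s" "s' \<in> R" "y' \<in> Hr s'" "the (m s y) = the (m s' y')"
    then show "s = s' \<and> y = y'" using mi[of s s' y _ y'] by (auto simp: Hr_def)
  qed
  have mset: "(\<lambda>(s, y). the (m s y)) ` (SIGMA s:R. Hr s) \<subseteq> H"
    by (auto simp: Hr_def)
  \<comment> \<open>\<open>Hr s\<close> supports the vector pulled back to the copy
    \<open>s\<close>. It is finite because \<open>m\<close> embeds all these supports injectively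
    into \<open>H\<close>.\<close>
  have "finite (SIGMA s:R. Hr s)"
    using finite_imageD[OF finite_subset[OF mset *(2)] minj_on] .
  have finH: "finite (Hr s)" if "s \<in> R" for s
  proof -
    have "Hr s \<subseteq> snd ` (SIGMA s:R. Hr s)" using that by force
    then show ?thesis using \<open>finite (SIGMA s:R. Hr s)\<close> by (meson finite_imageI finite_subset)
  qed
  have "(\<Sum>i<n. \<Sum>x\<in>G. (cmod (\<Sum>j<n. conv (b i j) (f j) x))\<^sup>2)
      = (\<Sum>i<n. \<Sum>x\<in>G'. (cmod (\<Sum>j<n. conv (b i j) (f j) x))\<^sup>2)"
    unfolding G'_def using * zero by (intro sum.cong refl sum.mono_neutral_right) auto
  also have "\<dots> = (\<Sum>i<n. \<Sum>s\<in>R. \<Sum>x\<in>Gr s. (cmod (\<Sum>j<n. conv (b i j) (f j) x))\<^sup>2)"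
    unfolding R_def Gr_def using fin(1) by (intro sum.cong refl sum.image_gen)
  also have "\<dots> = (\<Sum>s\<in>R. \<Sum>i<n. \<Sum>x\<in>Gr s. (cmod (\<Sum>j<n. conv (b i j) (f j) x))\<^sup>2)"
    by (rule sum.swap)
  \<comment> \<open>The bound for \<open>a\<close> is used once per copy: on a fibre of
    \<open>r\<close> the map \<open>q\<close> is injective, so distinct outputs stay
    distinct.\<close>
  also have "\<dots> \<le> (\<Sum>s\<in>R. c\<^sup>2 * (\<Sum>j<n. \<Sum>y\<in>Hr s. (cmod (pull m s (f j) y))\<^sup>2))"
  proof (intro sum_mono)
    fix s assume s: "s \<in> R"
    have "inj_on q (Gr s)"
      using inj by (auto simp: inj_on_def Gr_def G'_def)
    then have "(\<Sum>i<n. \<Sum>x\<in>Gr s. (cmod (\<Sum>j<n. conv (b i j) (f j) x))\<^sup>2)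
       = (\<Sum>i<n. \<Sum>x\<in>q ` Gr s. (cmod (\<Sum>j<n. conv (a i j) (pull m s (f j)) x))\<^sup>2)"
      by (auto simp: sum.reindex Gr_def G'_def eq)
    also have "\<dots> \<le> c\<^sup>2 * (\<Sum>j<n. \<Sum>y\<in>Hr s. (cmod (pull m s (f j) y))\<^sup>2)"
      using fin finH[OF s] q *(5) mU
      by (intro sym_boundD[OF a])
         (auto simp: Gr_def G'_def Hr_def pull_def split: option.splits)
    finally show "(\<Sum>i<n. \<Sum>x\<in>Gr s. (cmod (\<Sum>j<n. conv (b i j) (f j) x))\<^sup>2)
      \<le> c\<^sup>2 * (\<Sum>j<n. \<Sum>y\<in>Hr s. (cmod (pull m s (f j) y))\<^sup>2)" .
  qed
  also have "\<dots> = c\<^sup>2 * (\<Sum>j<n. \<Sum>s\<in>R. \<Sum>y\<in>Hr s. (cmod (pull m s (f j) y))\<^sup>2)"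
    by (subst sum.swap) (simp add: sum_distrib_left)
  \<comment> \<open>Different copies occupy disjoint parts of \<open>H\<close>, so the squared norms
    of the pulled vectors add up to at most that of \<open>f j\<close>.\<close>
  also have "\<dots> \<le> c\<^sup>2 * (\<Sum>j<n. \<Sum>y\<in>H. (cmod (f j y))\<^sup>2)"
  proof (intro mult_left_mono sum_mono)
    fix j
    have "(\<Sum>s\<in>R. \<Sum>y\<in>Hr s. (cmod (pull m s (f j) y))\<^sup>2)
        = (\<Sum>(s, y)\<in>(SIGMA s:R. Hr s). (cmod (pull m s (f j) y))\<^sup>2)"
      using fin finH by (intro sum.Sigma) auto
    also have "\<dots> = (\<Sum>(s, y)\<in>(SIGMA s:R. Hr s). (cmod (f j (the (m s y))))\<^sup>2)"
      by (intro sum.cong) (auto simp: Hr_def pull_def)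
    also have "\<dots> = (\<Sum>z\<in>(\<lambda>(s, y). the (m s y)) ` (SIGMA s:R. Hr s). (cmod (f j z))\<^sup>2)"
      by (subst sum.reindex[OF minj_on]) (simp add: case_prod_unfold)
    also have "\<dots> \<le> (\<Sum>z\<in>H. (cmod (f j z))\<^sup>2)"
      using mset *(2) by (intro sum_mono2) auto
    finally show "(\<Sum>s\<in>R. \<Sum>y\<in>Hr s. (cmod (pull m s (f j) y))\<^sup>2) \<le> (\<Sum>z\<in>H. (cmod (f j z))\<^sup>2)" .
  qed auto
  finally show "(\<Sum>i<n. \<Sum>x\<in>G. (cmod (\<Sum>j<n. conv (b i j) (f j) x))\<^sup>2)
     \<le> c\<^sup>2 * (\<Sum>j<n. \<Sum>y\<in>H. (cmod (f j y))\<^sup>2)" .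
qed

section \<open>Completely bounded maps of symbols\<close>

text \<open>Tests run over all words whatever \<open>k\<close> is, so these maps compose without
  domain bookkeeping; \<open>sym_bound_words_UNIV\<close> and \<open>sym_bound_subset\<close> pass
  from and to \<open>words k\<close>.\<close>

definition cb_sym :: "(vec \<Rightarrow> vec) \<Rightarrow> bool" where
  "cb_sym \<Phi> \<longleftrightarrow> (\<exists>C\<ge>0. \<forall>n a c. 0 \<le> c \<longrightarrow> sym_bound UNIV n a c \<longrightarrow> sym_bound UNIV n (\<lambda>i j. \<Phi> (a i j)) (C * c))"

lemma cb_symI:
  assumes "\<And>n a c. sym_bound UNIV n a c \<Longrightarrow> sym_bound UNIV n (\<lambda>i j. \<Phi> (a i j)) c"
  shows "cb_sym \<Phi>"
  unfolding cb_sym_def by (intro exI[of _ 1]) (simp add: assms)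

lemma cb_sym_id: "cb_sym (\<lambda>a. a)"
  by (rule cb_symI)

lemma cb_sym_comp:
  assumes "cb_sym \<Phi>" "cb_sym \<Psi>"
  shows "cb_sym (\<lambda>a. \<Phi> (\<Psi> a))"
proof -
  from assms obtain C D where C: "C \<ge> 0" "D \<ge> 0"
      "\<And>n a c. 0 \<le> c \<Longrightarrow> sym_bound UNIV n a c \<Longrightarrow> sym_bound UNIV n (\<lambda>i j. \<Phi> (a i j)) (C * c)"
      "\<And>n a c. 0 \<le> c \<Longrightarrow> sym_bound UNIV n a c \<Longrightarrow> sym_bound UNIV n (\<lambda>i j. \<Psi> (a i j)) (D * c)"
    unfolding cb_sym_def by blast
  have "sym_bound UNIV n (\<lambda>i j. \<Phi> (\<Psi> (a i j))) (C * D * c)" if "0 \<le> c" "sym_bound UNIV n a c" for n a c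
    unfolding mult.assoc using that C(1,2) by (intro C(3)) (auto intro: C(4))
  then show ?thesis unfolding cb_sym_def using C(1,2) by (intro exI[of _ "C * D"]) auto
qed

lemma cb_sym_add:
  assumes "cb_sym \<Phi>" "cb_sym \<Psi>"
  shows "cb_sym (\<lambda>a x. \<Phi> a x + \<Psi> a x)"
proof -
  from assms obtain C D where C: "C \<ge> 0" "D \<ge> 0"
      "\<And>n a c. 0 \<le> c \<Longrightarrow> sym_bound UNIV n a c \<Longrightarrow> sym_bound UNIV n (\<lambda>i j. \<Phi> (a i j)) (C * c)"
      "\<And>n a c. 0 \<le> c \<Longrightarrow> sym_bound UNIV n a c \<Longrightarrow> sym_bound UNIV n (\<lambda>i j. \<Psi> (a i j)) (D * c)"
    unfolding cb_sym_def by blast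
  have "sym_bound UNIV n (\<lambda>i j x. \<Phi> (a i j) x + \<Psi> (a i j) x) ((C + D) * c)"
    if "0 \<le> c" "sym_bound UNIV n a c" for n a c
    unfolding distrib_right using that C(1,2) by (intro sym_bound_add C(3,4)) auto
  then show ?thesis unfolding cb_sym_def using C(1,2) by (intro exI[of _ "C + D"]) auto
qed

lemma cb_sym_diff:
  assumes "cb_sym \<Phi>" "cb_sym \<Psi>"
  shows "cb_sym (\<lambda>a x. \<Phi> a x - \<Psi> a x)"
proof -
  have "cb_sym (\<lambda>a x. - a x)" by (rule cb_symI) (rule sym_bound_minus)
  from cb_sym_add[OF assms(1) cb_sym_comp[OF this assms(2)]] show ?thesis by simp
qed

section \<open>Constant terms and operations on the first letter\<close>

definition at_Nil :: "vec \<Rightarrow> vec" where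
  "at_Nil a x = (if x = [] then a [] else 0)"

lemma cb_sym_at_Nil: "cb_sym at_Nil"
proof (rule cb_symI)
  fix n and a :: "nat \<Rightarrow> nat \<Rightarrow> vec" and c
  assume a: "sym_bound UNIV n a c"
  have conv: "conv (at_Nil a) f x = a [] * f x" for a f x
  proof (cases x)
    case (Cons i v)
    have "(\<lambda>w. at_Nil a (i # w)) = (\<lambda>w. 0)" by (simp add: at_Nil_def)
    then show ?thesis by (simp add: Cons conv_zero) (simp add: at_Nil_def)
  qed (simp add: at_Nil_def)
  \<comment> \<open>One copy per word \<open>s\<close>: it uses only the matrix entry of
    \<open>a\<close> from the empty word to itself, placed at the coordinate \<open>s\<close> of the
    vector.\<close>
  show "sym_bound UNIV n (\<lambda>i j. at_Nil (a i j)) c"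
    by (rule sym_bound_transfer[OF a, where X = UNIV and r = "\<lambda>x. x" and q = "\<lambda>_. []" and
          m = "\<lambda>s y. if y = [] then Some s else None"])
       (auto simp: conv pull_def inj_on_def split: if_splits)
qed

text \<open>Removing the coefficient of the empty word is needed because relabelling first letters is
  spatial only on the part of the symbol supported on nonempty words.\<close>
lemma cb_sym_strip:
  assumes "\<And>n a c. (\<And>i j. a i j [] = 0) \<Longrightarrow> sym_bound UNIV n a c \<Longrightarrow> sym_bound UNIV n (\<lambda>i j. \<Phi> (a i j)) c"
    and eq: "\<And>a. \<Phi> (\<lambda>x. a x - at_Nil a x) = \<Phi> a"
  shows "cb_sym \<Phi>"
proof -
  have "cb_sym (\<lambda>a x. a x - at_Nil a x)" by (intro cb_sym_diff cb_sym_id cb_sym_at_Nil)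
  then obtain C where C: "C \<ge> 0" "\<And>n a c. 0 \<le> c \<Longrightarrow> sym_bound UNIV n a c \<Longrightarrow>
      sym_bound UNIV n (\<lambda>i j x. a i j x - at_Nil (a i j) x) (C * c)"
    unfolding cb_sym_def by blast
  have "sym_bound UNIV n (\<lambda>i j. \<Phi> (a i j)) (C * c)" if "0 \<le> c" "sym_bound UNIV n a c" for n a c
  proof -
    have "sym_bound UNIV n (\<lambda>i j. \<Phi> (\<lambda>x. a i j x - at_Nil (a i j) x)) (C * c)"
      by (rule assms(1)[OF _ C(2)[OF that]]) (simp add: at_Nil_def)
    then show ?thesis unfolding eq .
  qed
  then show ?thesis unfolding cb_sym_def using C(1) by blast
qed

text \<open>\<open>h\<close> points backwards, from a letter of the new symbol to the letter whose
  block it receives; \<open>None\<close> leaves the block zero.\<close>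

definition relabel :: "(nat \<Rightarrow> nat option) \<Rightarrow> vec \<Rightarrow> vec" where
  "relabel h a x = (case x of [] \<Rightarrow> 0 | i # v \<Rightarrow> (case h i of None \<Rightarrow> 0 | Some j \<Rightarrow> a (j # v)))"

text \<open>Without constant term the operator is a column of blocks, one per first letter, all
  acting on the same vector. Rearranging or dropping blocks of a column does not increase its norm,
  so a single copy with unchanged vectors suffices.\<close>

lemma cb_sym_relabel:
  assumes inj: "\<And>i i' j. h i = Some j \<Longrightarrow> h i' = Some j \<Longrightarrow> i = i'"
  shows "cb_sym (relabel h)"
proof (rule cb_sym_strip)
  fix n and a :: "nat \<Rightarrow> nat \<Rightarrow> vec" and c
  assume a0: "\<And>i j. a i j [] = 0" and a: "sym_bound UNIV n a c"
  have conv_Cons: "conv (relabel h a) f (i # v) =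
      (case h i of None \<Rightarrow> 0 | Some j \<Rightarrow> conv (\<lambda>w. a (j # w)) f v)" for a f i v
  proof -
    have "(\<lambda>w. relabel h a (i # w)) = (case h i of None \<Rightarrow> (\<lambda>w. 0) | Some j \<Rightarrow> (\<lambda>w. a (j # w)))"
      by (auto simp: relabel_def split: option.split)
    then show ?thesis by (simp add: conv_zero split: option.split) (simp add: relabel_def)
  qed
  have conv_Nil: "conv (relabel h a) f [] = 0" for a f
    by (simp add: relabel_def)
  show "sym_bound UNIV n (\<lambda>i j. relabel h (a i j)) c"
  proof (rule sym_bound_transfer[OF a, where X = "{x. x \<noteq> [] \<and> h (hd x) \<noteq> None}" and r = "\<lambda>x. ()" and
          q = "\<lambda>x. the (h (hd x)) # tl x" and m = "\<lambda>s y. Some y"])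
    show "inj_on (\<lambda>x. ((), the (h (hd x)) # tl x)) {x. x \<noteq> [] \<and> h (hd x) \<noteq> None}"
      using inj by (auto simp: inj_on_def neq_Nil_conv)
    show "conv (relabel h (a i j)) f x = 0" if "x \<notin> {x. x \<noteq> [] \<and> h (hd x) \<noteq> None}" for i j f x
      using that by (cases x) (auto simp: conv_Cons conv_Nil simp del: conv.simps)
    show "conv (relabel h (a i j)) f x = conv (a i j) (pull (\<lambda>s. Some) () f) (the (h (hd x)) # tl x)"
      if "x \<in> {x. x \<noteq> [] \<and> h (hd x) \<noteq> None}" for i j f x
    proof -
      have "pull (\<lambda>s. Some) () f = f" by (simp add: pull_def fun_eq_iff)
      moreover have "\<exists>l v l'. x = l # v \<and> h l = Some l'"
        using that by (cases x) auto
      then obtain l v l' where "x = l # v" "h l = Some l'" by blast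
      ultimately show ?thesis by (simp add: conv_Cons a0 del: conv.simps) (simp add: a0)
    qed
  qed auto
next
  show "relabel h (\<lambda>x. a x - at_Nil a x) = relabel h a" for a
    by (simp add: relabel_def at_Nil_def fun_eq_iff split: list.split option.split)
qed

definition push0 :: "vec \<Rightarrow> vec" where
  "push0 a x = (case x of [] \<Rightarrow> 0 | i # v \<Rightarrow> if i = 0 then a v else 0)"

text \<open>Left multiplication by the isometry \<open>Lop [0]\<close>.\<close>

lemma cb_sym_push0: "cb_sym push0"
proof (rule cb_symI)
  fix n and a :: "nat \<Rightarrow> nat \<Rightarrow> vec" and c
  assume a: "sym_bound UNIV n a c"
  have conv_Cons: "conv (push0 a) f (i # v) = (if i = 0 then conv a f v else 0)" for a f i v
  proof -
    have "(\<lambda>w. push0 a (i # w)) = (if i = 0 then a else (\<lambda>w. 0))"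
      by (auto simp: push0_def)
    then show ?thesis by (simp add: conv_zero) (simp add: push0_def)
  qed
  have conv_Nil: "conv (push0 a) f [] = 0" for a f by (simp add: push0_def)
  show "sym_bound UNIV n (\<lambda>i j. push0 (a i j)) c"
  proof (rule sym_bound_transfer[OF a, where X = "range ((#) 0)" and r = "\<lambda>x. ()" and
          q = tl and m = "\<lambda>s y. Some y"])
    show "conv (push0 (a i j)) f x = 0" if "x \<notin> range ((#) 0)" for i j f x
      using that by (cases x) (auto simp: conv_Cons conv_Nil simp del: conv.simps)
    show "conv (push0 (a i j)) f x = conv (a i j) (pull (\<lambda>s. Some) () f) (tl x)"
      if "x \<in> range ((#) 0)" for i j f x
    proof -
      have "pull (\<lambda>s. Some) () f = f" by (simp add: pull_def fun_eq_iff)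
      with that show ?thesis by (auto simp: conv_Cons simp del: conv.simps)
    qed
  qed (auto simp: inj_on_def)
qed

definition pop0 :: "vec \<Rightarrow> vec" where
  "pop0 a x = a (0 # x)"

text \<open>Left multiplication by the adjoint of \<open>Lop [0]\<close>. A constant term would
  leave a multiple of that adjoint, which is not a convolution; hence the stripping.\<close>

lemma cb_sym_pop0: "cb_sym pop0"
proof (rule cb_sym_strip)
  fix n and a :: "nat \<Rightarrow> nat \<Rightarrow> vec" and c
  assume a0: "\<And>i j. a i j [] = 0" and a: "sym_bound UNIV n a c"
  show "sym_bound UNIV n (\<lambda>i j. pop0 (a i j)) c"
  proof (rule sym_bound_transfer[OF a, where X = UNIV and r = "\<lambda>x. ()" and
          q = "\<lambda>x. 0 # x" and m = "\<lambda>s y. Some y"])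
    show "conv (pop0 (a i j)) f x = conv (a i j) (pull (\<lambda>s. Some) () f) (0 # x)" for i j f x
    proof -
      have "pull (\<lambda>s. Some) () f = f" "pop0 (a i j) = (\<lambda>w. a i j (0 # w))"
        by (simp_all add: pull_def pop0_def fun_eq_iff)
      then show ?thesis by (simp add: a0)
    qed
  qed (auto simp: inj_on_def)
next
  show "pop0 (\<lambda>x. a x - at_Nil a x) = pop0 a" for a
    by (simp add: pop0_def at_Nil_def fun_eq_iff)
qed

section \<open>Restriction of symbols to words in \<open>k\<close> letters\<close>

definition initial_part :: "enat \<Rightarrow> nat list \<Rightarrow> nat list" where
  "initial_part k = takeWhile (\<lambda>i. enat i < k)"

definition rest_part :: "enat \<Rightarrow> nat list \<Rightarrow> nat list" where
  "rest_part k = dropWhile (\<lambda>i. enat i < k)"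

definition glue :: "enat \<Rightarrow> nat list \<Rightarrow> nat list \<Rightarrow> nat list option" where
  "glue k s y = (if y \<in> words k then Some (y @ s) else None)"

lemma words_Nil [simp]: "[] \<in> words k"
  by (simp add: words_def)

lemma words_Cons [simp]: "i # w \<in> words k \<longleftrightarrow> enat i < k \<and> w \<in> words k"
  by (auto simp: words_def)

lemma words_append [simp]: "v @ w \<in> words k \<longleftrightarrow> v \<in> words k \<and> w \<in> words k"
  by (auto simp: words_def)

lemma words_infinity [simp]: "words \<infinity> = UNIV"
  by (simp add: words_def)

lemma initial_rest: "initial_part k x @ rest_part k x = x"
  by (simp add: initial_part_def rest_part_def)

lemma initial_in_words: "initial_part k x \<in> words k"
  by (auto simp: initial_part_def words_def dest: set_takeWhileD)

text \<open>A nonempty rest begins with a letter outside the \<open>k\<close> allowed ones, so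
  gluing creates no longer admissible prefix.\<close>

lemma initial_glue: "y \<in> words k \<Longrightarrow> initial_part k (y @ rest_part k x) = y"
  unfolding initial_part_def rest_part_def words_def
  by (induction y) (auto, metis hd_dropWhile takeWhile_eq_Nil_iff)

lemma glue_inj:
  assumes "glue k (rest_part k x) y = Some z" "glue k (rest_part k x') y' = Some z"
  shows "rest_part k x = rest_part k x' \<and> y = y'"
proof -
  have y: "y \<in> words k" "y' \<in> words k" and z: "y @ rest_part k x = y' @ rest_part k x'"
    using assms by (auto simp: glue_def split: if_splits)
  then have "y = y'" by (metis initial_glue)
  with z show ?thesis by simp
qed

text \<open>Cutting each word after its longest prefix in \<open>words k\<close> splits the big Fock
  space into copies of the small one, indexed by the rests. A prefix of \<open>x\<close> lying in
  \<open>words k\<close> is a prefix of \<open>initial_part k x\<close>, so the restricted symbol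
  acts inside each copy, as a compression of the original operator.\<close>

lemma conv_restrict:
  "conv (\<lambda>w. if w \<in> words k then a w else 0) f x = conv a (pull (glue k) (rest_part k x) f) (initial_part k x)"
proof (induction x arbitrary: a)
  case Nil
  then show ?case by (simp add: initial_part_def rest_part_def pull_def glue_def)
next
  case (Cons i x)
  show ?case
  proof (cases "enat i < k")
    case True
    have "pull (glue k) (rest_part k (i # x)) f (initial_part k (i # x)) = f (i # x)"
      by (simp add: pull_def glue_def initial_in_words initial_rest)
    with True Cons.IH[of "\<lambda>w. a (i # w)"] show ?thesis
      by (simp add: initial_part_def rest_part_def)
  next
    case False
    then show ?thesis by (simp add: initial_part_def rest_part_def conv_zero pull_def glue_def)
  qed
qed

text \<open>On the big Fock space such a symbol acts as a direct sum of copies of its action on the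
  small one, so the bound is unchanged.\<close>

lemma sym_bound_words_UNIV:
  assumes a: "sym_bound (words k) n a c"
    and supp: "\<And>i j w. i < n \<Longrightarrow> j < n \<Longrightarrow> w \<notin> words k \<Longrightarrow> a i j w = 0"
  shows "sym_bound UNIV n a c"
proof (rule sym_bound_transfer[OF a, where X = UNIV and r = "rest_part k" and q = "initial_part k" and m = "glue k"])
  show "inj_on (\<lambda>x. (rest_part k x, initial_part k x)) UNIV"
  proof (rule inj_onI)
    fix x y assume "(rest_part k x, initial_part k x) = (rest_part k y, initial_part k y)"
    then have "initial_part k x @ rest_part k x = initial_part k y @ rest_part k y" by simp
    then show "x = y" by (simp only: initial_rest)
  qed
  show "conv (a i j) f x = conv (a i j) (pull (glue k) (rest_part k x) f) (initial_part k x)"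
    if "i < n" "j < n" for i j f x
  proof -
    have "(\<lambda>w. if w \<in> words k then a i j w else 0) = a i j"
      using supp that by auto
    then show ?thesis using conv_restrict[of k "a i j" f x] by simp
  qed
  show "y \<in> words k" if "glue k s y = Some z" for s y z
    using that by (simp add: glue_def split: if_splits)
  show "rest_part k x = rest_part k x' \<and> y = y'"
    if "glue k (rest_part k x) y = Some z" "glue k (rest_part k x') y' = Some z" for x x' y y' z
    using that by (rule glue_inj)
qed (simp_all add: initial_in_words)

definition tail_in :: "enat \<Rightarrow> vec \<Rightarrow> vec" where
  "tail_in k a x = (case x of [] \<Rightarrow> 0 | i # v \<Rightarrow> if v \<in> words k then a (i # v) else 0)"

text \<open>Every block of the column is restricted as in \<open>conv_restrict\<close>. The copies
  are indexed by the rest of the tail, the same for all blocks; the first letter enters only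
  \<open>q\<close>.\<close>

lemma cb_sym_tail_in: "cb_sym (tail_in k)"
proof (rule cb_sym_strip)
  fix n and a :: "nat \<Rightarrow> nat \<Rightarrow> vec" and c
  assume a0: "\<And>i j. a i j [] = 0" and a: "sym_bound UNIV n a c"
  show "sym_bound UNIV n (\<lambda>i j. tail_in k (a i j)) c"
  proof (rule sym_bound_transfer[OF a, where X = "- {[]}" and r = "\<lambda>x. rest_part k (tl x)" and
        q = "\<lambda>x. hd x # initial_part k (tl x)" and m = "glue k"])
    show "inj_on (\<lambda>x. (rest_part k (tl x), hd x # initial_part k (tl x))) (- {[]})"
    proof (rule inj_onI)
      fix x y :: "nat list"
      assume "x \<in> - {[]}" "y \<in> - {[]}"
        "(rest_part k (tl x), hd x # initial_part k (tl x)) = (rest_part k (tl y), hd y # initial_part k (tl y))"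
      moreover from this have "initial_part k (tl x) @ rest_part k (tl x) = initial_part k (tl y) @ rest_part k (tl y)" by simp
      then have "tl x = tl y" by (simp only: initial_rest)
      ultimately show "x = y" by (auto intro: list.expand)
    qed
    show "conv (tail_in k (a i j)) f x = 0" if "x \<notin> - {[]}" for i j f x
      using that by (simp add: tail_in_def)
    show "conv (tail_in k (a i j)) f x =
        conv (a i j) (pull (glue k) (rest_part k (tl x)) f) (hd x # initial_part k (tl x))"
      if "x \<in> - {[]}" for i j f x
    proof (cases x)
      case (Cons l v)
      have "(\<lambda>w. tail_in k (a i j) (l # w)) = (\<lambda>w. if w \<in> words k then a i j (l # w) else 0)"
        by (simp add: tail_in_def fun_eq_iff)
      moreover have "tail_in k (a i j) [] = 0" by (simp add: tail_in_def)
      ultimately show ?thesis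
        using conv_restrict[of k "\<lambda>w. a i j (l # w)" f v] by (simp add: Cons a0)
    qed (use that in simp)
    show "rest_part k (tl x) = rest_part k (tl x') \<and> y = y'"
      if "glue k (rest_part k (tl x)) y = Some z" "glue k (rest_part k (tl x')) y' = Some z" for x x' y y' z
      using that by (rule glue_inj)
  qed simp_all
next
  show "tail_in k (\<lambda>x. a x - at_Nil a x) = tail_in k a" for a
    by (simp add: tail_in_def at_Nil_def fun_eq_iff split: list.split)
qed

section \<open>A bifix code and the word bijection\<close>

text \<open>The words \<open>0 1\<^sup>i 0\<close> form a prefix code, so \<open>\<theta>\<close> induces a complete isometry \<open>encode\<close>, and a
  suffix code, so compression to the span of \<open>range \<theta>\<close> gives the left inverse \<open>decode\<close>.\<close>
definition code :: "nat \<Rightarrow> nat list" where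
  "code i = 0 # replicate i 1 @ [0]"

definition \<theta> :: "nat list \<Rightarrow> nat list" where
  "\<theta> w = concat (map code w)"

lemma theta_Nil [simp]: "\<theta> [] = []"
  and theta_Cons [simp]: "\<theta> (i # w) = code i @ \<theta> w"
  and theta_append [simp]: "\<theta> (v @ w) = \<theta> v @ \<theta> w"
  by (simp_all add: \<theta>_def)

lemma theta_eq_Nil [simp]: "\<theta> w = [] \<longleftrightarrow> w = []"
  by (cases w) (simp_all add: code_def)

lemma code_append_inject: "code i @ x = code j @ y \<longleftrightarrow> i = j \<and> x = y"
proof
  have "replicate i (1::nat) @ 0 # x = replicate j 1 @ 0 # y \<Longrightarrow> i = j \<and> x = y"
  proof (induction i arbitrary: j)
    case 0
    then show ?case by (cases j) auto
  next
    case (Suc i)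
    then show ?case by (cases j) auto
  qed
  then show "i = j \<and> x = y" if "code i @ x = code j @ y"
    using that by (simp add: code_def)
qed simp

text \<open>Code words are palindromes, so reversal turns the prefix property into the suffix
  property.\<close>

lemma rev_theta: "rev (\<theta> w) = \<theta> (rev w)"
  by (induction w) (simp_all add: code_def)

text \<open>The remainders left after reading code words off the left as long as possible;
  \<open>\<theta> y @ s\<close> with such an \<open>s\<close> is a unique normal form of
  words.\<close>

definition code_free :: "nat list \<Rightarrow> bool" where
  "code_free s \<longleftrightarrow> (\<forall>i z. s \<noteq> code i @ z)"

lemma code_free_Nil: "code_free []"
  by (simp add: code_free_def code_def)

lemma theta_code_free_unique:
  assumes "code_free s" "code_free s'" "\<theta> y @ s = \<theta> y' @ s'"
  shows "y = y' \<and> s = s'"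
  using assms(3)
proof (induction y arbitrary: y')
  case Nil
  then show ?case using assms(1) by (cases y') (auto simp: code_free_def)
next
  case (Cons i y)
  then obtain j u where y': "y' = j # u"
    using assms(2) by (cases y') (auto simp: code_free_def)
  then have "code i @ (\<theta> y @ s) = code j @ (\<theta> u @ s')" using Cons.prems by simp
  then have "i = j" "\<theta> y @ s = \<theta> u @ s'" unfolding code_append_inject by auto
  then show ?case using Cons.IH y' by blast
qed

lemma theta_code_free_exists: "\<exists>y s. x = \<theta> y @ s \<and> code_free s"
proof (induction "length x" arbitrary: x rule: less_induct)
  case less
  show ?case
  proof (cases "code_free x")
    case True
    then show ?thesis by (metis append_Nil theta_Nil)
  next
    case False
    then obtain i z where x: "x = code i @ z" by (auto simp: code_free_def)
    then have "length z < length x" by (simp add: code_def)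
    from less[OF this] obtain y s where "z = \<theta> y @ s" "code_free s" by blast
    then have "x = \<theta> (i # y) @ s \<and> code_free s" by (simp add: x)
    then show ?thesis by blast
  qed
qed

lemma inj_theta: "inj \<theta>"
  by (rule injI) (metis append_Nil2 code_free_Nil theta_code_free_unique)

lemma inv_theta [simp]: "inv \<theta> (\<theta> w) = w"
  by (rule inv_f_f[OF inj_theta])

lemma inv_theta_Nil [simp]: "inv \<theta> [] = []"
  using inv_theta[of "[]"] by simp

lemma theta_prefix:
  assumes "code_free s" "\<theta> w @ z = \<theta> y @ s"
  obtains y' where "y = w @ y'" "z = \<theta> y' @ s"
proof -
  obtain y' s' where z: "z = \<theta> y' @ s'" "code_free s'" using theta_code_free_exists by blast
  have "\<theta> (w @ y') @ s' = \<theta> y @ s" using assms(2) z by simp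
  from theta_code_free_unique[OF z(2) assms(1) this] show thesis using that z by blast
qed

lemma theta_suffix:
  assumes "w @ \<theta> z = \<theta> x"
  obtains w' where "w = \<theta> w'" "x = w' @ z"
proof -
  have "rev (w @ \<theta> z) = rev (\<theta> x)" using assms by simp
  then have "\<theta> (rev z) @ rev w = \<theta> (rev x) @ []" by (simp add: rev_theta)
  from theta_prefix[OF code_free_Nil this] obtain y where y: "rev x = rev z @ y" "rev w = \<theta> y"
    by auto
  have "x = rev (rev x)" by simp
  also have "\<dots> = rev y @ z" by (simp add: y)
  finally have x: "x = rev y @ z" .
  have "w = rev (rev w)" by simp
  also have "\<dots> = \<theta> (rev y)" unfolding y(2) by (rule rev_theta)
  finally show thesis using that x by blast
qed

definition encode :: "vec \<Rightarrow> vec" where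
  "encode a x = (if x \<in> range \<theta> then a (inv \<theta> x) else 0)"

definition decode :: "vec \<Rightarrow> vec" where
  "decode a x = a (\<theta> x)"

text \<open>By the prefix property, a first factor in \<open>range \<theta>\<close> ends between two
  code words of \<open>\<theta> y\<close>, or at an end of it, and \<open>s\<close> is carried
  along. Encoding is thus an amplification, with one copy per remainder.\<close>

lemma conv_encode:
  assumes "code_free s"
  shows "conv (encode a) f (\<theta> y @ s) = conv a (pull (\<lambda>s y. Some (\<theta> y @ s)) s f) y"
proof -
  let ?g = "\<lambda>(w, z). (\<theta> w, \<theta> z @ s)"
  have inj: "inj_on ?g (splits y)"
    by (auto simp: inj_on_def inj_theta[THEN inj_eq])
  have "conv (encode a) f (\<theta> y @ s) = (\<Sum>p\<in>?g ` splits y. encode a (fst p) * f (snd p))"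
    unfolding conv_splits case_prod_unfold
  proof (rule sum.mono_neutral_right)
    show "\<forall>p\<in>splits (\<theta> y @ s) - (\<lambda>p. (\<theta> (fst p), \<theta> (snd p) @ s)) ` splits y.
        encode a (fst p) * f (snd p) = 0"
    proof
      fix p assume p: "p \<in> splits (\<theta> y @ s) - (\<lambda>p. (\<theta> (fst p), \<theta> (snd p) @ s)) ` splits y"
      have "fst p \<notin> range \<theta>"
      proof
        assume "fst p \<in> range \<theta>"
        then obtain w where w: "fst p = \<theta> w" by blast
        then have "\<theta> w @ snd p = \<theta> y @ s" using p by (auto simp: splits_def)
        from theta_prefix[OF assms this] obtain y' where "y = w @ y'" "snd p = \<theta> y' @ s" .
        then have "p = (\<lambda>p. (\<theta> (fst p), \<theta> (snd p) @ s)) (w, y')" "(w, y') \<in> splits y"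
          using w by (auto simp: splits_def prod_eq_iff)
        then show False using p by blast
      qed
      then show "encode a (fst p) * f (snd p) = 0" by (simp add: encode_def)
    qed
  qed (auto simp: finite_splits, auto simp: splits_def)
  also have "\<dots> = (\<Sum>(w, z)\<in>splits y. a w * f (\<theta> z @ s))"
    by (subst sum.reindex[OF inj]) (simp add: case_prod_unfold encode_def)
  finally show ?thesis by (simp add: conv_splits pull_def)
qed

lemma cb_sym_encode: "cb_sym encode"
proof (rule cb_symI)
  fix n and a :: "nat \<Rightarrow> nat \<Rightarrow> vec" and c
  assume a: "sym_bound UNIV n a c"
  obtain q r where qr: "\<And>x. x = \<theta> (q x) @ r x" "\<And>x. code_free (r x)"
    using theta_code_free_exists by metis
  show "sym_bound UNIV n (\<lambda>i j. encode (a i j)) c"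
  proof (rule sym_bound_transfer[OF a, where X = UNIV and r = r and q = q and
        m = "\<lambda>s y. Some (\<theta> y @ s)"])
    show "inj_on (\<lambda>x. (r x, q x)) UNIV"
    proof (rule inj_onI)
      fix x y assume "(r x, q x) = (r y, q y)"
      then have "\<theta> (q x) @ r x = \<theta> (q y) @ r y" by simp
      then show "x = y" by (simp only: qr(1)[symmetric])
    qed
    show "conv (encode (a i j)) f x = conv (a i j) (pull (\<lambda>s y. Some (\<theta> y @ s)) (r x) f) (q x)"
      for i j f x
      using conv_encode[OF qr(2), of "a i j" f "q x" x] by (simp only: qr(1)[symmetric])
    show "r x = r x' \<and> y = y'" if "Some (\<theta> y @ r x) = Some z" "Some (\<theta> y' @ r x') = Some z"
      for x x' y y' z
      using theta_code_free_unique[OF qr(2)[of x] qr(2)[of x'], of y y'] that by simp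
  qed simp_all
qed

definition decode_word :: "unit \<Rightarrow> nat list \<Rightarrow> nat list option" where
  "decode_word s y = (if y \<in> range \<theta> then Some (inv \<theta> y) else None)"

text \<open>\<open>pull\<close> admits only second factors in \<open>range \<theta>\<close>, and the
  suffix property then forces the first factors into it too.\<close>

lemma conv_decode: "conv (decode a) f x = conv a (pull decode_word () f) (\<theta> x)"
proof -
  let ?g = "\<lambda>(w, z). (\<theta> w, \<theta> z)"
  have inj: "inj_on ?g (splits x)"
    by (auto simp: inj_on_def inj_theta[THEN inj_eq])
  have "conv a (pull decode_word () f) (\<theta> x) = (\<Sum>p\<in>?g ` splits x. a (fst p) * pull decode_word () f (snd p))"
    unfolding conv_splits case_prod_unfold
  proof (rule sum.mono_neutral_right)
    show "\<forall>p\<in>splits (\<theta> x) - (\<lambda>p. (\<theta> (fst p), \<theta> (snd p))) ` splits x.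
        a (fst p) * pull decode_word () f (snd p) = 0"
    proof
      fix p assume p: "p \<in> splits (\<theta> x) - (\<lambda>p. (\<theta> (fst p), \<theta> (snd p))) ` splits x"
      have "snd p \<notin> range \<theta>"
      proof
        assume "snd p \<in> range \<theta>"
        then obtain z where z: "snd p = \<theta> z" by blast
        then have "fst p @ \<theta> z = \<theta> x" using p by (auto simp: splits_def)
        from theta_suffix[OF this] obtain w where "fst p = \<theta> w" "x = w @ z" .
        then have "p = (\<lambda>p. (\<theta> (fst p), \<theta> (snd p))) (w, z)" "(w, z) \<in> splits x"
          using z by (auto simp: splits_def prod_eq_iff)
        then show False using p by blast
      qed
      then show "a (fst p) * pull decode_word () f (snd p) = 0" by (simp add: pull_def decode_word_def)
    qed
  qed (auto simp: finite_splits, auto simp: splits_def)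
  also have "\<dots> = (\<Sum>(w, z)\<in>splits x. a (\<theta> w) * f z)"
    by (subst sum.reindex[OF inj]) (simp add: case_prod_unfold pull_def decode_word_def)
  finally show ?thesis by (simp add: conv_splits decode_def)
qed

lemma cb_sym_decode: "cb_sym decode"
proof (rule cb_symI)
  fix n and a :: "nat \<Rightarrow> nat \<Rightarrow> vec" and c
  assume a: "sym_bound UNIV n a c"
  show "sym_bound UNIV n (\<lambda>i j. decode (a i j)) c"
  proof (rule sym_bound_transfer[OF a, where X = UNIV and r = "\<lambda>_. ()" and q = \<theta> and m = decode_word])
    show "inj_on (\<lambda>x. ((), \<theta> x)) UNIV"
      by (auto simp: inj_on_def inj_theta[THEN inj_eq])
    show "() = () \<and> y = y'" if "decode_word () y = Some z" "decode_word () y' = Some z" for y y' z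
      using that by (auto simp: decode_word_def split: if_splits)
  qed (simp_all add: conv_decode)
qed

text \<open>The Pelczynski decomposition, unrolled. Words \<open>i v\<close> with \<open>v\<close> a nonempty word in \<open>k\<close> letters are
  shifted down in \<open>i\<close> and all words then encoded with even first letter; the freed words \<open>0 v\<close>
  provide the complement of \<open>range \<theta>\<close> and, for \<open>v\<close> in \<open>range \<theta>\<close>, the codes with odd first letter.\<close>
definition \<sigma> :: "enat \<Rightarrow> nat list \<Rightarrow> nat list" where
  "\<sigma> k w = (case w of [] \<Rightarrow> []
     | i # v \<Rightarrow>
         if v \<in> words k \<and> v \<noteq> [] then
           (case i of
              0 \<Rightarrow> if v \<in> range \<theta>
                   then (case inv \<theta> v of [] \<Rightarrow> [] | j # u \<Rightarrow> \<theta> ((2 * j + 1) # u))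
                   else v
            | Suc l \<Rightarrow> \<theta> (2 * l # v))
         else \<theta> (2 * i # v))"

text \<open>The parity of the first decoded letter separates the two encoded summands; for an even
  letter, the condition on \<open>u\<close> tells whether the shift has to be undone.\<close>

definition \<rho> :: "enat \<Rightarrow> nat list \<Rightarrow> nat list" where
  "\<rho> k x = (if x = [] then []
     else if x \<in> range \<theta> then
       (case inv \<theta> x of [] \<Rightarrow> []
        | j # u \<Rightarrow>
            if odd j then 0 # \<theta> (j div 2 # u)
            else if u \<in> words k \<and> u \<noteq> [] then Suc (j div 2) # u
            else j div 2 # u)
     else 0 # x)"

text \<open>Only the letters 0 and 1 occur in code words, and \<open>2 \<le> k\<close> provides
  them.\<close>

lemma code_in_words:
  assumes "2 \<le> k"
  shows "code i \<in> words k"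
proof -
  have "enat 0 < k" "enat 1 < k" using assms by (cases k; simp add: numeral_eq_enat)+
  then show ?thesis by (auto simp: words_def code_def)
qed

lemma theta_in_words: "2 \<le> k \<Longrightarrow> \<theta> w \<in> words k"
  by (induction w) (simp_all add: code_in_words)

lemma sigma_in_words:
  assumes "2 \<le> k"
  shows "\<sigma> k w \<in> words k"
  using theta_in_words[OF assms]
  by (auto simp: \<sigma>_def simp del: theta_Cons split: list.split nat.split)

lemma rho_sigma:
  assumes "2 \<le> k"
  shows "\<rho> k (\<sigma> k w) = w"
proof (cases w)
  case Nil
  then show ?thesis by (simp add: \<sigma>_def \<rho>_def)
next
  case (Cons i v)
  show ?thesis
  proof (cases "v \<in> words k \<and> v \<noteq> []")
    case True
    note v = this
    show ?thesis
    proof (cases i)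
      case 0
      show ?thesis
      proof (cases "v \<in> range \<theta>")
        case True
        then obtain j u where "v = \<theta> (j # u)" using v
          by (metis list.exhaust rangeE theta_Nil)
        then show ?thesis using v
          by (simp add: Cons 0 \<sigma>_def \<rho>_def del: theta_Cons)
      next
        case False
        then show ?thesis using v by (simp add: Cons 0 \<sigma>_def \<rho>_def)
      qed
    next
      case (Suc l)
      then show ?thesis using v by (simp add: Cons \<sigma>_def \<rho>_def del: theta_Cons)
    qed
  next
    case False
    then have "\<sigma> k w = \<theta> (2 * i # v)" by (auto simp: Cons \<sigma>_def simp del: theta_Cons)
    then show ?thesis using False by (auto simp: Cons \<rho>_def simp del: theta_Cons)
  qed
qed

lemma sigma_rho:
  assumes "2 \<le> k" "x \<in> words k"
  shows "\<sigma> k (\<rho> k x) = x"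
proof (cases "x \<in> range \<theta> \<and> x \<noteq> []")
  case True
  then obtain j u where x: "x = \<theta> (j # u)"
    by (metis list.exhaust rangeE theta_Nil)
  show ?thesis
  proof (cases "odd j")
    case True
    then obtain l where "j = 2 * l + 1" by (elim oddE)
    moreover have "\<theta> (l # u) \<in> words k" by (rule theta_in_words[OF assms(1)])
    ultimately show ?thesis by (simp add: x \<sigma>_def \<rho>_def del: theta_Cons)
  next
    case False
    then obtain l where "j = 2 * l" by blast
    then show ?thesis by (auto simp: x \<sigma>_def \<rho>_def simp del: theta_Cons)
  qed
next
  case False
  then show ?thesis using assms(2) by (auto simp: \<sigma>_def \<rho>_def)
qed

section \<open>The maps of symbols induced by the word bijection\<close>

definition fwd :: "enat \<Rightarrow> vec \<Rightarrow> vec" where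
  "fwd k a x = (if x \<in> words k then a (\<rho> k x) else 0)"

definition bwd :: "enat \<Rightarrow> vec \<Rightarrow> vec" where
  "bwd k b w = b (\<sigma> k w)"

text \<open>\<open>tail_in 0\<close> keeps exactly the one-letter words. They are excluded because
  removing the letter of \<open>[0]\<close> would give the empty word, which is already matched with
  itself.\<close>

definition tail_pos :: "enat \<Rightarrow> vec \<Rightarrow> vec" where
  "tail_pos k a x = tail_in k a x - tail_in 0 a x"

lemma words_0: "words 0 = {[]}"
  by (auto simp: words_def zero_enat_def[symmetric])

lemma tail_pos_Nil [simp]: "tail_pos k a [] = 0"
  by (simp add: tail_pos_def tail_in_def)

lemma tail_pos_Cons [simp]:
  "tail_pos k a (i # v) = (if v \<in> words k \<and> v \<noteq> [] then a (i # v) else 0)"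
  by (simp add: tail_pos_def tail_in_def words_0)

lemma cb_sym_tail_pos: "cb_sym (tail_pos k)"
  unfolding tail_pos_def[abs_def] by (intro cb_sym_diff cb_sym_tail_in)

lemma relabel_Nil [simp]: "relabel h a [] = 0"
  and relabel_Cons [simp]:
    "relabel h a (i # v) = (case h i of None \<Rightarrow> 0 | Some j \<Rightarrow> a (j # v))"
  by (simp_all add: relabel_def)

lemma push0_Nil [simp]: "push0 a [] = 0"
  and push0_Cons [simp]: "push0 a (i # v) = (if i = 0 then a v else 0)"
  by (simp_all add: push0_def)

abbreviation (input) odd_half :: "nat \<Rightarrow> nat option" where
  "odd_half j \<equiv> (if odd j then Some (j div 2) else None)"

abbreviation (input) even_half :: "nat \<Rightarrow> nat option" where
  "even_half j \<equiv> (if even j then Some (j div 2) else None)"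

text \<open>\<open>pop0 (tail_pos k a)\<close> is the freed copy: the bracket projects it off
  \<open>range \<theta>\<close>, and its decoded part goes to the odd letters. The even letters
  receive the remaining columns, shifted down, and everything outside the columns.\<close>

lemma fwd_eq:
  assumes "2 \<le> k"
  shows "fwd k a x = at_Nil a x
      + (pop0 (tail_pos k a) x - encode (decode (pop0 (tail_pos k a))) x)
      + encode (\<lambda>z. relabel odd_half (decode (pop0 (tail_pos k a))) z
          + relabel even_half (\<lambda>y. relabel (\<lambda>i. Some (Suc i)) (tail_pos k a) y
              + (a y - tail_pos k a y)) z) x"
proof (cases "x \<in> range \<theta> \<and> x \<noteq> []")
  case True
  then obtain j u where x: "x = \<theta> (j # u)"
    by (metis list.exhaust rangeE theta_Nil)
  have w: "\<theta> w \<in> words k" for w by (rule theta_in_words[OF assms])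
  show ?thesis
    unfolding x fwd_def \<rho>_def at_Nil_def pop0_def encode_def decode_def
    by (auto simp: w simp del: theta_Cons)
next
  case False
  then show ?thesis
    by (auto simp: fwd_def \<rho>_def at_Nil_def pop0_def encode_def decode_def)
qed

lemma cb_sym_fwd:
  assumes "2 \<le> k"
  shows "cb_sym (fwd k)"
proof -
  have "cb_sym (\<lambda>a. pop0 (tail_pos k a))" by (intro cb_sym_comp[OF cb_sym_pop0] cb_sym_tail_pos)
  note * = this cb_sym_comp[OF cb_sym_decode this]
  have "cb_sym (\<lambda>a x. at_Nil a x
      + (pop0 (tail_pos k a) x - encode (decode (pop0 (tail_pos k a))) x)
      + encode (\<lambda>z. relabel odd_half (decode (pop0 (tail_pos k a))) z
          + relabel even_half (\<lambda>y. relabel (\<lambda>i. Some (Suc i)) (tail_pos k a) y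
              + (a y - tail_pos k a y)) z) x)"
    by (intro cb_sym_add cb_sym_diff cb_sym_at_Nil cb_sym_comp[OF cb_sym_encode] cb_sym_comp[OF cb_sym_relabel]
        cb_sym_tail_pos cb_sym_id *) (auto split: if_splits elim!: oddE evenE)
  then show ?thesis unfolding fwd_eq[OF assms, symmetric] .
qed

text \<open>A completely bounded extension of \<open>bwd k\<close> from the symbols supported in
  \<open>words k\<close>. \<open>d\<close> reads the even codes, \<open>push0\<close> rebuilds the
  freed words from the complement and the odd codes, and the last relabelling shifts the columns
  back up.\<close>

definition bwd_op :: "enat \<Rightarrow> vec \<Rightarrow> vec" where
  "bwd_op k b x = (let b' = (\<lambda>x. b x - at_Nil b x);
       d = relabel (\<lambda>i. Some (2 * i)) (decode b)
     in at_Nil b x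
       + push0 (\<lambda>v. b' v - encode (decode b') v
           + encode (relabel (\<lambda>i. Some (2 * i + 1)) (decode b)) v) x
       + (relabel (\<lambda>i. case i of 0 \<Rightarrow> None | Suc l \<Rightarrow> Some l) (tail_pos k d) x
       + (d x - tail_pos k d x)))"

text \<open>The support condition acts at words \<open>0 # v\<close> with \<open>v\<close> outside
  \<open>words k\<close>, where \<open>push0\<close> would contribute a stray
  \<open>b v\<close>.\<close>

lemma bwd_eq:
  assumes "2 \<le> k" "\<And>w. w \<notin> words k \<Longrightarrow> b w = 0"
  shows "bwd k b w = bwd_op k b w"
proof (cases w)
  case Nil
  then show ?thesis by (simp add: bwd_def \<sigma>_def bwd_op_def Let_def at_Nil_def)
next
  case (Cons i v)
  have th: "\<theta> u \<in> words k" for u by (rule theta_in_words[OF assms(1)])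
  show ?thesis
  proof (cases "v \<in> range \<theta>")
    case True
    then obtain u where v: "v = \<theta> u" by blast
    show ?thesis
      by (cases u; cases i)
        (auto simp: v th Cons bwd_def \<sigma>_def bwd_op_def Let_def at_Nil_def encode_def decode_def
          simp del: theta_Cons)
  next
    case False
    then have "v \<noteq> []" by (metis rangeI theta_Nil)
    with False assms(2)[of v] show ?thesis
      by (cases i; cases "v \<in> words k")
        (auto simp: Cons bwd_def \<sigma>_def bwd_op_def Let_def at_Nil_def encode_def decode_def
          simp del: theta_Cons)
  qed
qed

lemma cb_sym_bwd_op: "cb_sym (bwd_op k)"
proof -
  have 1: "cb_sym (\<lambda>b x. b x - at_Nil b x)" by (intro cb_sym_diff cb_sym_at_Nil cb_sym_id)
  have 2: "cb_sym (\<lambda>b. relabel (\<lambda>i. Some (2 * i)) (decode b))"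
    by (intro cb_sym_comp[OF cb_sym_relabel] cb_sym_decode) auto
  show ?thesis
    unfolding bwd_op_def[abs_def] Let_def
    by (intro cb_sym_add cb_sym_diff cb_sym_at_Nil cb_sym_comp[OF cb_sym_push0] cb_sym_comp[OF cb_sym_encode]
        cb_sym_comp[OF cb_sym_relabel] cb_sym_comp[OF cb_sym_decode] cb_sym_comp[OF cb_sym_tail_pos] 1 2 cb_sym_decode cb_sym_id)
      (auto split: nat.splits)
qed

section \<open>Symbols of operators in the algebras\<close>

definition supp_in :: "enat \<Rightarrow> vec \<Rightarrow> bool" where
  "supp_in k a \<longleftrightarrow> (\<forall>w. w \<notin> words k \<longrightarrow> a w = 0)"

section \<open>Square-summable vectors and the passage from finite tests to norms\<close>

lemma l2norm_nonneg: "0 \<le> l2norm f"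
  by (simp add: l2norm_def infsum_nonneg)

lemma l2norm_sq: "(l2norm f)\<^sup>2 = infsum (\<lambda>w. (cmod (f w))\<^sup>2) UNIV"
  by (simp add: l2norm_def infsum_nonneg)

lemma l2_supp: "f \<in> l2 k \<Longrightarrow> supp_in k f"
  by (simp add: l2_def supp_in_def)

lemma sum_le_l2norm_sq:
  assumes "f \<in> l2 k" "finite G"
  shows "(\<Sum>w\<in>G. (cmod (f w))\<^sup>2) \<le> (l2norm f)\<^sup>2"
  unfolding l2norm_sq using assms by (intro finite_sum_le_infsum) (auto simp: l2_def)

lemma cmod_le_l2norm:
  assumes "f \<in> l2 k"
  shows "cmod (f w) \<le> l2norm f"
  using sum_le_l2norm_sq[OF assms, of "{w}"] l2norm_nonneg[of f]
  by (simp add: power2_le_iff_abs_le)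

lemma l2I:
  assumes "supp_in k f" "\<And>G. finite G \<Longrightarrow> G \<subseteq> words k \<Longrightarrow> (\<Sum>w\<in>G. (cmod (f w))\<^sup>2) \<le> B"
  shows "f \<in> l2 k"
proof -
  have "(\<Sum>w\<in>G. (cmod (f w))\<^sup>2) \<le> B" if "finite G" for G
  proof -
    have "(\<Sum>w\<in>G. (cmod (f w))\<^sup>2) = (\<Sum>w\<in>G \<inter> words k. (cmod (f w))\<^sup>2)"
      using assms(1) that by (intro sum.mono_neutral_right) (auto simp: supp_in_def)
    also have "\<dots> \<le> B" using that by (intro assms(2)) auto
    finally show ?thesis .
  qed
  then have "(\<lambda>w. (cmod (f w))\<^sup>2) summable_on UNIV"
    by (intro nonneg_bdd_above_summable_on) (auto intro!: bdd_aboveI[of _ B])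
  then show ?thesis using assms(1) by (simp add: l2_def supp_in_def)
qed

lemma l2_add:
  assumes "f \<in> l2 k" "g \<in> l2 k"
  shows "(\<lambda>w. f w + g w) \<in> l2 k"
proof (rule l2I[where B = "2 * (l2norm f)\<^sup>2 + 2 * (l2norm g)\<^sup>2"])
  show "supp_in k (\<lambda>w. f w + g w)"
    using assms[THEN l2_supp] by (simp add: supp_in_def)
  fix G :: "nat list set" assume G: "finite G"
  have "(cmod (f w + g w))\<^sup>2 \<le> 2 * (cmod (f w))\<^sup>2 + 2 * (cmod (g w))\<^sup>2" for w
  proof -
    have "(cmod (f w + g w))\<^sup>2 \<le> (cmod (f w) + cmod (g w))\<^sup>2"
      by (intro power_mono norm_triangle_ineq) auto
    also have "\<dots> \<le> 2 * (cmod (f w))\<^sup>2 + 2 * (cmod (g w))\<^sup>2"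
      using zero_le_power2[of "cmod (f w) - cmod (g w)"] unfolding power2_diff power2_sum by linarith
    finally show ?thesis .
  qed
  then have "(\<Sum>w\<in>G. (cmod (f w + g w))\<^sup>2)
      \<le> (\<Sum>w\<in>G. 2 * (cmod (f w))\<^sup>2 + 2 * (cmod (g w))\<^sup>2)"
    by (rule sum_mono)
  also have "\<dots> = 2 * (\<Sum>w\<in>G. (cmod (f w))\<^sup>2) + 2 * (\<Sum>w\<in>G. (cmod (g w))\<^sup>2)"
    by (simp add: sum.distrib sum_distrib_left)
  also have "\<dots> \<le> 2 * (l2norm f)\<^sup>2 + 2 * (l2norm g)\<^sup>2"
    using sum_le_l2norm_sq[OF assms(1) G] sum_le_l2norm_sq[OF assms(2) G] by simp
  finally show "(\<Sum>w\<in>G. (cmod (f w + g w))\<^sup>2) \<le> 2 * (l2norm f)\<^sup>2 + 2 * (l2norm g)\<^sup>2" .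
qed

lemma l2_scale:
  assumes "f \<in> l2 k"
  shows "(\<lambda>w. c * f w) \<in> l2 k"
proof (rule l2I[where B = "(cmod c)\<^sup>2 * (l2norm f)\<^sup>2"])
  show "supp_in k (\<lambda>w. c * f w)" using l2_supp[OF assms] by (simp add: supp_in_def)
  fix G :: "nat list set" assume G: "finite G"
  show "(\<Sum>w\<in>G. (cmod (c * f w))\<^sup>2) \<le> (cmod c)\<^sup>2 * (l2norm f)\<^sup>2"
    using sum_le_l2norm_sq[OF assms G]
    by (simp add: norm_mult power_mult_distrib sum_distrib_left[symmetric] mult_left_mono)
qed

lemma l2_finite:
  assumes "finite H" "H \<subseteq> words k" "\<And>w. w \<notin> H \<Longrightarrow> f w = 0"
  shows "f \<in> l2 k" and "(l2norm f)\<^sup>2 = (\<Sum>w\<in>H. (cmod (f w))\<^sup>2)"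
proof -
  have "((\<lambda>w. (cmod (f w))\<^sup>2) has_sum (\<Sum>w\<in>H. (cmod (f w))\<^sup>2)) UNIV"
    using assms by (intro has_sum_finite_neutralI) auto
  then show "f \<in> l2 k" "(l2norm f)\<^sup>2 = (\<Sum>w\<in>H. (cmod (f w))\<^sup>2)"
    using assms(2,3) by (auto simp: l2_def l2norm_sq has_sum_imp_summable infsumI)
qed

lemma l2_sum:
  assumes "finite I" "\<And>i. i \<in> I \<Longrightarrow> f i \<in> l2 k"
  shows "(\<lambda>w. \<Sum>i\<in>I. f i w) \<in> l2 k"
  using assms
proof (induction I rule: finite_induct)
  case empty
  then show ?case by (simp add: l2_finite(1)[of "{}"])
next
  case (insert i I)
  then show ?case by (simp add: l2_add)
qed

lemma Lop_in_l2:
  assumes "f \<in> l2 k" "x \<in> words k"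
  shows "Lop x f \<in> l2 k"
proof (rule l2I[where B = "(l2norm f)\<^sup>2"])
  show "supp_in k (Lop x f)"
    unfolding supp_in_def
  proof (intro allI impI)
    fix w assume w: "w \<notin> words k"
    show "Lop x f w = 0"
    proof (cases "take (length x) w = x")
      case True
      then have "w = x @ drop (length x) w" by (metis append_take_drop_id)
      then have "drop (length x) w \<notin> words k" using w assms(2) by (metis words_append)
      then show ?thesis using l2_supp[OF assms(1)] by (simp add: Lop_def supp_in_def)
    qed (simp add: Lop_def)
  qed
  fix G :: "nat list set" assume G: "finite G"
  define G' where "G' = {w \<in> G. take (length x) w = x}"
  have inj: "inj_on (drop (length x)) G'"
    by (rule inj_onI) (metis (mono_tags, lifting) G'_def append_take_drop_id mem_Collect_eq)
  have "(\<Sum>w\<in>G. (cmod (Lop x f w))\<^sup>2) = (\<Sum>w\<in>G'. (cmod (f (drop (length x) w)))\<^sup>2)"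
    unfolding G'_def using G by (intro sum.mono_neutral_cong_right) (auto simp: Lop_def)
  also have "\<dots> = (\<Sum>w\<in>drop (length x) ` G'. (cmod (f w))\<^sup>2)"
    by (simp add: sum.reindex[OF inj])
  also have "\<dots> \<le> (l2norm f)\<^sup>2"
    using G by (intro sum_le_l2norm_sq[OF assms(1)]) (simp add: G'_def)
  finally show "(\<Sum>w\<in>G. (cmod (Lop x f w))\<^sup>2) \<le> (l2norm f)\<^sup>2" .
qed

lemma Lop_eq_conv: "Lop x f w = conv (\<lambda>y. if y = x then 1 else 0) f w"
proof (induction w arbitrary: x)
  case Nil
  then show ?case by (cases x) (simp_all add: Lop_def)
next
  case (Cons i w)
  show ?case
  proof (cases x)
    case Nil
    then show ?thesis by (simp add: Lop_def conv_zero)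
  next
    case (Cons l y)
    show ?thesis
    proof (cases "l = i")
      case True
      then show ?thesis by (simp add: Cons Cons.IH[symmetric] Lop_def)
    next
      case False
      then have "(\<lambda>w. if i # w = x then 1 else 0) = (\<lambda>w. 0::complex)" by (auto simp: Cons)
      then show ?thesis using False by (simp add: Cons Lop_def conv_zero)
    qed
  qed
qed

lemma conv_sum: "finite F \<Longrightarrow> conv (\<lambda>w. \<Sum>x\<in>F. a x w) f y = (\<Sum>x\<in>F. conv (a x) f y)"
  by (induction F rule: finite_induct) (simp_all add: conv_zero conv_add)

lemma conv_finite:
  assumes "finite F"
  shows "conv (\<lambda>x. if x \<in> F then c x else 0) f w = (\<Sum>x\<in>F. c x * Lop x f w)"
proof -
  have "(\<lambda>x. if x \<in> F then c x else 0) = (\<lambda>y. \<Sum>x\<in>F. c x * (if y = x then 1 else 0))"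
    using assms by (auto simp: fun_eq_iff if_distrib cong: if_cong)
  then show ?thesis using assms by (simp add: conv_sum conv_scale Lop_eq_conv del: mult_if_delta)
qed

definition poly_sym :: "enat \<Rightarrow> vec \<Rightarrow> bool" where
  "poly_sym k s \<longleftrightarrow> finite {w. s w \<noteq> 0} \<and> supp_in k s"

lemma poly_symE:
  assumes "poly_sym k s"
  obtains F where "finite F" "F \<subseteq> words k" "s = (\<lambda>x. if x \<in> F then s x else 0)"
proof
  show "finite {w. s w \<noteq> 0}" "{w. s w \<noteq> 0} \<subseteq> words k"
    using assms by (auto simp: poly_sym_def supp_in_def)
qed auto

lemma Lspan_eq: "Lspan k = conv ` {s. poly_sym k s}"
proof (intro set_eqI iffI)
  fix S assume "S \<in> Lspan k"
  then obtain F c where F: "S = (\<lambda>f w. \<Sum>x\<in>F. c x * Lop x f w)" "finite F" "F \<subseteq> words k"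
    by (auto simp: Lspan_def)
  have "S = conv (\<lambda>x. if x \<in> F then c x else 0)"
    by (simp add: F fun_eq_iff conv_finite)
  moreover have "poly_sym k (\<lambda>x. if x \<in> F then c x else 0)"
    using F(2,3) by (auto simp: poly_sym_def supp_in_def)
  ultimately show "S \<in> conv ` {s. poly_sym k s}" by blast
next
  fix S assume "S \<in> conv ` {s. poly_sym k s}"
  then obtain s where s: "S = conv s" "poly_sym k s" by blast
  obtain F where F: "finite F" "F \<subseteq> words k" "s = (\<lambda>x. if x \<in> F then s x else 0)"
    using poly_symE[OF s(2)] .
  have "S = (\<lambda>f w. \<Sum>x\<in>F. s x * Lop x f w)"
    unfolding s(1) by (subst F(3)) (simp add: conv_finite[OF F(1)] fun_eq_iff)
  then show "S \<in> Lspan k" using F by (auto simp: Lspan_def)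
qed

lemma poly_sym_l2:
  assumes "poly_sym k s" "f \<in> l2 k"
  shows "conv s f \<in> l2 k"
proof -
  obtain F where F: "finite F" "F \<subseteq> words k" "s = (\<lambda>x. if x \<in> F then s x else 0)"
    using poly_symE[OF assms(1)] .
  have "conv s f = (\<lambda>w. \<Sum>x\<in>F. s x * Lop x f w)"
    by (subst F(3)) (simp add: conv_finite[OF F(1)] fun_eq_iff)
  also have "\<dots> \<in> l2 k" using F by (intro l2_sum l2_scale Lop_in_l2 assms(2)) auto
  finally show ?thesis .
qed

lemma conv_supp:
  assumes "supp_in k a" "supp_in k f"
  shows "supp_in k (conv a f)"
  unfolding supp_in_def
proof (intro allI impI)
  fix x assume "x \<notin> words k"
  then have "a (fst p) * f (snd p) = 0" if "p \<in> splits x" for p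
    using assms that by (auto simp: supp_in_def splits_def)
  then show "conv a f x = 0" unfolding conv_splits case_prod_unfold by (intro sum.neutral ballI)
qed

lemma has_sum_finite_sum:
  fixes f :: "'i \<Rightarrow> 'b \<Rightarrow> real"
  assumes "finite I" "\<And>i. i \<in> I \<Longrightarrow> (f i has_sum s i) A"
  shows "((\<lambda>x. \<Sum>i\<in>I. f i x) has_sum (\<Sum>i\<in>I. s i)) A"
  using assms by (induction I rule: finite_induct) (auto intro: has_sum_add)

lemma sym_bound_imp_l2:
  assumes a: "sym_bound (words k) n a c"
    and supp: "\<And>i j. i < n \<Longrightarrow> j < n \<Longrightarrow> supp_in k (a i j)"
    and f: "\<And>j. j < n \<Longrightarrow> f j \<in> l2 k"
  shows "\<And>i. i < n \<Longrightarrow> (\<lambda>w. \<Sum>j<n. conv (a i j) (f j) w) \<in> l2 k"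
    and "(\<Sum>i<n. (l2norm (\<lambda>w. \<Sum>j<n. conv (a i j) (f j) w))\<^sup>2) \<le> c\<^sup>2 * (\<Sum>j<n. (l2norm (f j))\<^sup>2)"
proof -
  define B where "B = c\<^sup>2 * (\<Sum>j<n. (l2norm (f j))\<^sup>2)"
  define g where "g = (\<lambda>i w. \<Sum>j<n. conv (a i j) (f j) w)"
  have supp_g: "supp_in k (g i)" if "i < n" for i
    using conv_supp[OF supp[OF that] l2_supp[OF f]]
    by (auto simp: g_def supp_in_def intro!: sum.neutral)
  have fin: "(\<Sum>i<n. \<Sum>x\<in>G. (cmod (g i x))\<^sup>2) \<le> B" if G: "finite G" "G \<subseteq> words k" for G
  proof -
    \<comment> \<open>All right factors of words in \<open>G\<close>, a finite set: truncating
      \<open>f\<close> to it leaves the convolution on \<open>G\<close> unchanged, so finite tests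
      apply to every \<open>f\<close>.\<close>
    define H where "H = (\<Union>x\<in>G. snd ` splits x)"
    have H: "finite H" "H \<subseteq> words k"
      using G by (auto simp: H_def finite_splits) (auto simp: splits_def)
    define f' where "f' = (\<lambda>j w. if w \<in> H then f j w else 0)"
    have "conv b (f' j) x = conv b (f j) x" if "x \<in> G" for b j x
      unfolding conv_splits
    proof (rule sum.cong[OF refl], clarify)
      fix w z assume "(w, z) \<in> splits x"
      then have "z \<in> H" unfolding H_def using that by force
      then show "b w * f' j z = b w * f j z" by (simp add: f'_def)
    qed
    then have "(\<Sum>i<n. \<Sum>x\<in>G. (cmod (g i x))\<^sup>2)
        = (\<Sum>i<n. \<Sum>x\<in>G. (cmod (\<Sum>j<n. conv (a i j) (f' j) x))\<^sup>2)"
      by (simp add: g_def)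
    also have "\<dots> \<le> c\<^sup>2 * (\<Sum>j<n. \<Sum>y\<in>H. (cmod (f' j y))\<^sup>2)"
      by (intro sym_boundD[OF a] G H) (simp add: f'_def)
    also have "\<dots> = c\<^sup>2 * (\<Sum>j<n. \<Sum>y\<in>H. (cmod (f j y))\<^sup>2)"
      by (simp add: f'_def)
    also have "\<dots> \<le> B"
      unfolding B_def using f by (intro mult_left_mono sum_mono sum_le_l2norm_sq H) auto
    finally show ?thesis .
  qed
  have g: "g i \<in> l2 k" if "i < n" for i
  proof (rule l2I[OF supp_g[OF that]])
    fix G assume G: "finite G" "G \<subseteq> words k"
    have "(\<Sum>x\<in>G. (cmod (g i x))\<^sup>2) \<le> (\<Sum>i<n. \<Sum>x\<in>G. (cmod (g i x))\<^sup>2)"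
      using that by (intro member_le_sum[where f = "\<lambda>i. \<Sum>x\<in>G. (cmod (g i x))\<^sup>2"] sum_nonneg) auto
    also note fin[OF G]
    finally show "(\<Sum>x\<in>G. (cmod (g i x))\<^sup>2) \<le> B" .
  qed
  then show "\<And>i. i < n \<Longrightarrow> (\<lambda>w. \<Sum>j<n. conv (a i j) (f j) w) \<in> l2 k"
    by (simp add: g_def)
  have summable: "(\<lambda>x. (cmod (g i x))\<^sup>2) summable_on UNIV" if "i < n" for i
    using g[OF that] by (simp add: l2_def)
  \<comment> \<open>All rows are put into one series over words, so that the joint finite bound
    applies; bounding the rows separately would lose a factor \<open>n\<close>.\<close>
  have sum: "((\<lambda>x. \<Sum>i<n. (cmod (g i x))\<^sup>2) has_sum (\<Sum>i<n. (l2norm (g i))\<^sup>2)) UNIV"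
    unfolding l2norm_sq using summable by (intro has_sum_finite_sum) (auto intro: has_sum_infsum)
  have "(\<Sum>i<n. (l2norm (g i))\<^sup>2) \<le> B"
    unfolding infsumI[OF sum, symmetric]
  proof (rule infsum_le_finite_sums)
    show "(\<lambda>x. \<Sum>i<n. (cmod (g i x))\<^sup>2) summable_on UNIV"
      using sum by (rule has_sum_imp_summable)
    fix G :: "nat list set" assume G: "finite G"
    have "(\<Sum>x\<in>G. \<Sum>i<n. (cmod (g i x))\<^sup>2) = (\<Sum>x\<in>G \<inter> words k. \<Sum>i<n. (cmod (g i x))\<^sup>2)"
      using G supp_g by (intro sum.mono_neutral_right) (auto simp: supp_in_def intro!: sum.neutral)
    also have "\<dots> \<le> B" using fin[of "G \<inter> words k"] G by (subst sum.swap) auto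
    finally show "(\<Sum>x\<in>G. \<Sum>i<n. (cmod (g i x))\<^sup>2) \<le> B" .
  qed
  then show "(\<Sum>i<n. (l2norm (\<lambda>w. \<Sum>j<n. conv (a i j) (f j) w))\<^sup>2)
      \<le> c\<^sup>2 * (\<Sum>j<n. (l2norm (f j))\<^sup>2)"
    by (simp add: g_def B_def)
qed

lemma l2_imp_sym_bound:
  assumes l2: "\<And>f i. (\<And>j. j < n \<Longrightarrow> f j \<in> l2 k) \<Longrightarrow> i < n \<Longrightarrow>
      (\<lambda>w. \<Sum>j<n. conv (a i j) (f j) w) \<in> l2 k"
    and le: "\<And>f. (\<And>j. j < n \<Longrightarrow> f j \<in> l2 k) \<Longrightarrow>
      (\<Sum>i<n. (l2norm (\<lambda>w. \<Sum>j<n. conv (a i j) (f j) w))\<^sup>2) \<le> c\<^sup>2 * (\<Sum>j<n. (l2norm (f j))\<^sup>2)"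
  shows "sym_bound (words k) n a c"
proof (rule sym_boundI)
  fix G H and f :: "nat \<Rightarrow> vec"
  assume *: "finite G" "finite H" "G \<subseteq> words k" "H \<subseteq> words k"
    and f0: "\<And>j w. j < n \<Longrightarrow> w \<notin> H \<Longrightarrow> f j w = 0"
  have f: "f j \<in> l2 k" "(l2norm (f j))\<^sup>2 = (\<Sum>w\<in>H. (cmod (f j w))\<^sup>2)" if "j < n" for j
    using l2_finite[OF *(2,4) f0[OF that]] by auto
  have "(\<Sum>i<n. \<Sum>x\<in>G. (cmod (\<Sum>j<n. conv (a i j) (f j) x))\<^sup>2)
      \<le> (\<Sum>i<n. (l2norm (\<lambda>w. \<Sum>j<n. conv (a i j) (f j) w))\<^sup>2)"
    using l2[OF f(1)] *(1) by (intro sum_mono sum_le_l2norm_sq) auto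
  also have "\<dots> \<le> c\<^sup>2 * (\<Sum>j<n. (l2norm (f j))\<^sup>2)" by (rule le[OF f(1)])
  finally show "(\<Sum>i<n. \<Sum>x\<in>G. (cmod (\<Sum>j<n. conv (a i j) (f j) x))\<^sup>2)
      \<le> c\<^sup>2 * (\<Sum>j<n. \<Sum>y\<in>H. (cmod (f j y))\<^sup>2)"
    by (simp add: f(2))
qed

lemma op_bound_iff_sym_bound:
  assumes "supp_in k a" "0 \<le> c" "\<And>f. f \<in> l2 k \<Longrightarrow> T f = conv a f"
  shows "op_bound k T c \<longleftrightarrow> sym_bound (words k) 1 (\<lambda>_ _. a) c"
proof
  assume T: "op_bound k T c"
  show "sym_bound (words k) 1 (\<lambda>_ _. a) c"
  proof (rule l2_imp_sym_bound)
    fix f :: "nat \<Rightarrow> vec"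
    assume "\<And>j. j < 1 \<Longrightarrow> f j \<in> l2 k"
    then have f: "f 0 \<in> l2 k" by simp
    then have "conv a (f 0) \<in> l2 k" and le: "l2norm (conv a (f 0)) \<le> c * l2norm (f 0)"
      using T assms(3)[OF f] by (auto simp: op_bound_def)
    then show "(\<lambda>w. \<Sum>j<1. conv a (f j) w) \<in> l2 k" by simp
    have "(l2norm (conv a (f 0)))\<^sup>2 \<le> (c * l2norm (f 0))\<^sup>2"
      by (intro power_mono le l2norm_nonneg)
    then show "(\<Sum>i<1::nat. (l2norm (\<lambda>w. \<Sum>j<1. conv a (f j) w))\<^sup>2) \<le> c\<^sup>2 * (\<Sum>j<1. (l2norm (f j))\<^sup>2)"
      by (simp add: power_mult_distrib)
  qed
next
  assume a: "sym_bound (words k) 1 (\<lambda>_ _. a) c"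
  show "op_bound k T c"
    unfolding op_bound_def
  proof (intro ballI)
    fix f assume f: "f \<in> l2 k"
    have "(l2norm (conv a f))\<^sup>2 \<le> (c * l2norm f)\<^sup>2"
      using sym_bound_imp_l2(2)[OF a, where f = "\<lambda>_. f"] assms(1) f by (simp add: power_mult_distrib)
    then have "l2norm (conv a f) \<le> c * l2norm f"
      by (rule power2_le_imp_le) (simp add: assms(2) l2norm_nonneg)
    moreover have "conv a f \<in> l2 k"
      using sym_bound_imp_l2(1)[OF a, where f = "\<lambda>_. f" and i = 0] assms(1) f by simp
    ultimately show "T f \<in> l2 k \<and> l2norm (T f) \<le> c * l2norm f"
      by (simp add: assms(3)[OF f])
  qed
qed

section \<open>Operators of the algebra as convolutions\<close>

definition opr :: "enat \<Rightarrow> vec \<Rightarrow> oper" where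
  "opr k a f = (if f \<in> l2 k then conv a f else (\<lambda>w. 0))"

definition symb :: "oper \<Rightarrow> vec" where
  "symb T = T (\<lambda>w. if w = [] then 1 else 0)"

lemma delta_l2: "(\<lambda>w. if w = [] then 1 else 0) \<in> l2 k"
  by (rule l2_finite(1)[of "{[]}"]) auto

lemma conv_delta: "conv a (\<lambda>w. if w = [] then 1 else 0) x = a x"
  by (induction x arbitrary: a) simp_all

lemma symb_opr [simp]: "symb (opr k a) = a"
  by (simp add: symb_def opr_def delta_l2 conv_delta fun_eq_iff)

text \<open>Membership in the norm closure, read off the symbol; \<open>Alg_opr\<close> and
  \<open>AlgE\<close> are the two directions.\<close>

definition alg_sym :: "enat \<Rightarrow> vec \<Rightarrow> bool" where
  "alg_sym k a \<longleftrightarrow> supp_in k a \<and>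
     (\<forall>\<epsilon>>0. \<exists>s. poly_sym k s \<and> sym_bound (words k) 1 (\<lambda>_ _ w. a w - s w) \<epsilon>)"

lemma supp_in_diff: "supp_in k a \<Longrightarrow> supp_in k b \<Longrightarrow> supp_in k (\<lambda>w. a w - b w)"
  by (simp add: supp_in_def)

lemma alg_sym_l2:
  assumes "alg_sym k a" "f \<in> l2 k"
  shows "conv a f \<in> l2 k"
proof -
  obtain s where s: "poly_sym k s" "sym_bound (words k) 1 (\<lambda>_ _ w. a w - s w) 1"
    using assms(1) unfolding alg_sym_def by (meson zero_less_one)
  have "supp_in k (\<lambda>w. a w - s w)"
    using assms(1) s(1) by (intro supp_in_diff) (auto simp: alg_sym_def poly_sym_def)
  with sym_bound_imp_l2(1)[OF s(2), where f = "\<lambda>_. f" and i = 0] assms(2)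
  have "conv (\<lambda>w. a w - s w) f \<in> l2 k" by simp
  from l2_add[OF this poly_sym_l2[OF s(1) assms(2)]] show ?thesis
    by (simp add: conv_diff)
qed

lemma Alg_opr:
  assumes "alg_sym k a"
  shows "opr k a \<in> Alg k"
  unfolding Alg_def
proof (intro CollectI conjI allI impI)
  show "opr k a f = (\<lambda>w. 0)" if "f \<notin> l2 k" for f using that by (simp add: opr_def)
  fix \<epsilon> :: real assume "\<epsilon> > 0"
  then obtain s where s: "poly_sym k s" "sym_bound (words k) 1 (\<lambda>_ _ w. a w - s w) \<epsilon>"
    using assms unfolding alg_sym_def by blast
  have "supp_in k (\<lambda>w. a w - s w)"
    using assms s(1) by (intro supp_in_diff) (auto simp: alg_sym_def poly_sym_def)
  from op_bound_iff_sym_bound[OF this, of \<epsilon> "\<lambda>f w. opr k a f w - conv s f w"] s(2) \<open>\<epsilon> > 0\<close>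
  have "op_bound k (\<lambda>f w. opr k a f w - conv s f w) \<epsilon>"
    by (simp add: opr_def conv_diff fun_eq_iff)
  then show "\<exists>S\<in>Lspan k. op_bound k (\<lambda>f w. opr k a f w - S f w) \<epsilon>"
    using s(1) by (auto simp: Lspan_eq)
qed

lemma small_imp_zero:
  fixes x K :: real
  assumes "\<And>\<epsilon>. \<epsilon> > 0 \<Longrightarrow> x \<le> \<epsilon> * K" "0 \<le> K"
  shows "x \<le> 0"
proof (rule ccontr)
  assume "\<not> x \<le> 0"
  then have x: "x > 0" by simp
  then have "x \<le> x / (K + 1) * K" using assms by (intro assms(1)) auto
  then show False using x assms(2) by (simp add: field_simps)
qed

text \<open>The approximants are convolutions, and so is their limit: testing the error on the
  vacuum vector controls every coefficient, and the value of a convolution at a fixed word is a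
  finite sum over its factorizations.\<close>

lemma AlgE:
  assumes T: "T \<in> Alg k"
  obtains "alg_sym k (symb T)" "T = opr k (symb T)"
proof
  define a where "a = symb T"
  define d :: vec where "d = (\<lambda>w. if w = [] then 1 else 0)"
  have d: "d \<in> l2 k" unfolding d_def by (rule delta_l2)
  have approx: "\<exists>s. poly_sym k s \<and> op_bound k (\<lambda>f w. T f w - conv s f w) \<epsilon>" if "\<epsilon> > 0" for \<epsilon>
    using T that by (auto simp: Alg_def Lspan_eq)
  have T_l2: "T f \<in> l2 k" if f: "f \<in> l2 k" for f
  proof -
    obtain s where s: "poly_sym k s" "op_bound k (\<lambda>f w. T f w - conv s f w) 1"
      using approx[of 1] by auto
    then have "(\<lambda>w. T f w - conv s f w) \<in> l2 k" using f by (auto simp: op_bound_def)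
    from l2_add[OF this poly_sym_l2[OF s(1) f]] show ?thesis by simp
  qed
  have T_eq: "T f = conv a f" if f: "f \<in> l2 k" for f
  proof
    fix w
    \<comment> \<open>The first term pays for replacing \<open>T\<close> by an approximant, the
      second for replacing the coefficients of the approximant by those of \<open>a\<close>.
      \<open>K\<close> does not depend on the approximant.\<close>
    define K where "K = l2norm f + (\<Sum>p\<in>splits w. l2norm d * cmod (f (snd p)))"
    have "cmod (T f w - conv a f w) \<le> \<epsilon> * K" if e: "\<epsilon> > 0" for \<epsilon>
    proof -
      obtain s where s: "poly_sym k s" "op_bound k (\<lambda>f w. T f w - conv s f w) \<epsilon>"
        using approx[OF e] by auto
      have pt: "cmod (T g v - conv s g v) \<le> \<epsilon> * l2norm g" if g: "g \<in> l2 k" for g v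
      proof -
        have *: "(\<lambda>w. T g w - conv s g w) \<in> l2 k"
             "l2norm (\<lambda>w. T g w - conv s g w) \<le> \<epsilon> * l2norm g"
          using s(2) g by (auto simp: op_bound_def)
        from cmod_le_l2norm[OF *(1), of v] *(2) show ?thesis by simp
      qed
      have as: "cmod (a v - s v) \<le> \<epsilon> * l2norm d" for v
        using pt[OF d, of v] by (simp add: a_def symb_def d_def conv_delta)
      have "cmod (conv (\<lambda>w. a w - s w) f w)
          \<le> (\<Sum>p\<in>splits w. cmod ((a (fst p) - s (fst p)) * f (snd p)))"
        unfolding conv_splits case_prod_unfold by (rule norm_sum)
      also have "\<dots> \<le> (\<Sum>p\<in>splits w. \<epsilon> * (l2norm d * cmod (f (snd p))))"
        unfolding norm_mult mult.assoc[symmetric] by (intro sum_mono mult_right_mono as) auto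
      finally have 1: "cmod (conv a f w - conv s f w)
          \<le> \<epsilon> * (\<Sum>p\<in>splits w. l2norm d * cmod (f (snd p)))"
        by (simp add: conv_diff sum_distrib_left)
      have "cmod (T f w - conv a f w)
          \<le> cmod (T f w - conv s f w) + cmod (conv a f w - conv s f w)"
        using norm_triangle_ineq4[of "T f w - conv s f w" "conv a f w - conv s f w"] by simp
      also have "\<dots> \<le> \<epsilon> * K"
        using 1 pt[OF f, of w] by (simp add: K_def distrib_left)
      finally show ?thesis .
    qed
    moreover have "0 \<le> K" unfolding K_def by (intro add_nonneg_nonneg sum_nonneg) (auto simp: l2norm_nonneg)
    ultimately have "cmod (T f w - conv a f w) \<le> 0" by (rule small_imp_zero)
    then show "T f w = conv a f w" by simp
  qed
  show "T = opr k (symb T)"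
    using T by (auto simp: fun_eq_iff opr_def T_eq a_def Alg_def)
  have supp: "supp_in k a" using T_l2[OF d] by (auto simp: a_def symb_def d_def dest: l2_supp)
  have "\<exists>s. poly_sym k s \<and> sym_bound (words k) 1 (\<lambda>_ _ w. a w - s w) \<epsilon>" if e: "\<epsilon> > 0" for \<epsilon>
  proof -
    obtain s where s: "poly_sym k s" "op_bound k (\<lambda>f w. T f w - conv s f w) \<epsilon>"
      using approx[OF e] by auto
    have "supp_in k (\<lambda>w. a w - s w)"
      using supp s(1) by (intro supp_in_diff) (auto simp: poly_sym_def)
    from op_bound_iff_sym_bound[OF this, of \<epsilon> "\<lambda>f w. T f w - conv s f w"] s e show ?thesis
      by (auto simp: T_eq conv_diff fun_eq_iff)
  qed
  then show "alg_sym k (symb T)" using supp by (simp add: alg_sym_def a_def)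
qed

lemma mat_bound_iff_sym_bound:
  assumes "\<And>i j. i < n \<Longrightarrow> j < n \<Longrightarrow> alg_sym k (a i j)"
    and T: "\<And>i j. i < n \<Longrightarrow> j < n \<Longrightarrow> T i j = opr k (a i j)"
  shows "mat_bound k n T c \<longleftrightarrow> sym_bound (words k) n a c"
proof -
  have eq: "(\<lambda>w. \<Sum>j<n. T i j (f j) w) = (\<lambda>w. \<Sum>j<n. conv (a i j) (f j) w)"
    if "i < n" "\<And>j. j < n \<Longrightarrow> f j \<in> l2 k" for i f
    using that by (simp add: T opr_def)
  show ?thesis
  proof
    assume "mat_bound k n T c"
    then have *: "(\<Sum>i<n. (l2norm (\<lambda>w. \<Sum>j<n. T i j (f j) w))\<^sup>2) \<le> c\<^sup>2 * (\<Sum>j<n. (l2norm (f j))\<^sup>2)"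
      if "\<And>j. j < n \<Longrightarrow> f j \<in> l2 k" for f
      using that unfolding mat_bound_def by blast
    show "sym_bound (words k) n a c"
    proof (rule l2_imp_sym_bound)
      fix f :: "nat \<Rightarrow> vec" and i
      assume f: "\<And>j. j < n \<Longrightarrow> f j \<in> l2 k"
      show "(\<lambda>w. \<Sum>j<n. conv (a i j) (f j) w) \<in> l2 k" if "i < n"
        using assms(1)[OF that] f by (intro l2_sum alg_sym_l2) auto
      show "(\<Sum>i<n. (l2norm (\<lambda>w. \<Sum>j<n. conv (a i j) (f j) w))\<^sup>2) \<le> c\<^sup>2 * (\<Sum>j<n. (l2norm (f j))\<^sup>2)"
        using *[OF f] eq[OF _ f] by simp
    qed
  next
    assume a: "sym_bound (words k) n a c"
    show "mat_bound k n T c"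
      unfolding mat_bound_def
    proof (intro allI impI)
      fix f :: "nat \<Rightarrow> vec" assume f: "\<forall>j<n. f j \<in> l2 k"
      then show "(\<Sum>i<n. (l2norm (\<lambda>w. \<Sum>j<n. T i j (f j) w))\<^sup>2) \<le> c\<^sup>2 * (\<Sum>j<n. (l2norm (f j))\<^sup>2)"
        using sym_bound_imp_l2(2)[OF a, of f] assms(1) eq[of _ f] by (simp add: alg_sym_def)
    qed
  qed
qed

text \<open>Conditions under which a map of symbols induces one of algebras: \<open>poly\<close>
  keeps approximants polynomial, and \<open>cb\<close> carries the approximation to the limit. The
  bound is asked only for supported symbols, where \<open>bwd\<close> agrees with its completely
  bounded extension.\<close>

locale symbol_map =
  fixes k k' :: enat and F :: "vec \<Rightarrow> vec" and C :: real
  assumes C: "0 \<le> C"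
    and cb: "\<And>n a c. 0 \<le> c \<Longrightarrow> (\<And>i j. i < n \<Longrightarrow> j < n \<Longrightarrow> supp_in k (a i j)) \<Longrightarrow>
        sym_bound (words k) n a c \<Longrightarrow> sym_bound (words k') n (\<lambda>i j. F (a i j)) (C * c)"
    and linear: "\<And>t a b. F (\<lambda>w. t * a w + b w) = (\<lambda>w. t * F a w + F b w)"
    and poly: "\<And>s. poly_sym k s \<Longrightarrow> poly_sym k' (F s)"
    and supp: "\<And>a. supp_in k a \<Longrightarrow> supp_in k' (F a)"
begin

definition \<Phi> :: "oper \<Rightarrow> oper" where
  "\<Phi> T = opr k' (F (symb T))"

lemma F_diff: "F (\<lambda>w. a w - b w) = (\<lambda>w. F a w - F b w)"
  using linear[of "-1" b a] by simp

lemma alg_sym_F: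
  assumes "alg_sym k a"
  shows "alg_sym k' (F a)"
  unfolding alg_sym_def
proof (intro conjI allI impI)
  show "supp_in k' (F a)" using assms by (intro supp) (simp add: alg_sym_def)
  fix \<epsilon> :: real assume e: "\<epsilon> > 0"
  \<comment> \<open>Chosen so that \<open>C * \<eta> \<le> \<epsilon>\<close>; the added 1 covers
    \<open>C = 0\<close>.\<close>
  define \<eta> where "\<eta> = \<epsilon> / (C + 1)"
  have eta: "\<eta> > 0" using e C by (simp add: \<eta>_def)
  then obtain s where s: "poly_sym k s" "sym_bound (words k) 1 (\<lambda>_ _ w. a w - s w) \<eta>"
    using assms unfolding alg_sym_def by blast
  have "supp_in k (\<lambda>w. a w - s w)"
    using assms s(1) by (intro supp_in_diff) (auto simp: alg_sym_def poly_sym_def)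
  then have "sym_bound (words k') 1 (\<lambda>_ _. F (\<lambda>w. a w - s w)) (C * \<eta>)"
    using eta s(2) by (intro cb) auto
  then have "sym_bound (words k') 1 (\<lambda>_ _. F (\<lambda>w. a w - s w)) \<epsilon>"
    by (rule sym_bound_mono) (use C e in \<open>auto simp: \<eta>_def field_simps\<close>)
  then show "\<exists>s. poly_sym k' s \<and> sym_bound (words k') 1 (\<lambda>_ _ w. F a w - s w) \<epsilon>"
    using poly[OF s(1)] by (auto simp: F_diff)
qed

lemma Phi_Alg: "T \<in> Alg k \<Longrightarrow> \<Phi> T \<in> Alg k'"
  by (erule AlgE) (simp add: \<Phi>_def Alg_opr alg_sym_F)

lemma lin_on_Phi: "lin_on k \<Phi>"
  unfolding lin_on_def
proof (intro ballI allI)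
  fix S T t
  have "symb (\<lambda>f w. t * S f w + T f w) = (\<lambda>w. t * symb S w + symb T w)"
    by (simp add: symb_def)
  then show "\<Phi> (\<lambda>f w. t * S f w + T f w) = (\<lambda>f w. t * \<Phi> S f w + \<Phi> T f w)"
    unfolding \<Phi>_def by (simp add: linear) (simp add: opr_def fun_eq_iff conv_add conv_scale)
qed

lemma cb_on_Phi: "cb_on k k' \<Phi>"
  unfolding cb_on_def
proof (intro exI[of _ C] conjI allI impI C)
  fix n and T :: "nat \<Rightarrow> nat \<Rightarrow> oper" and c :: real
  assume T: "\<forall>i<n. \<forall>j<n. T i j \<in> Alg k" and c: "c \<ge> 0" and mat: "mat_bound k n T c"
  have *: "alg_sym k (symb (T i j))" "T i j = opr k (symb (T i j))" if "i < n" "j < n" for i j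
  proof -
    have "T i j \<in> Alg k" using T that by blast
    then show "alg_sym k (symb (T i j))" "T i j = opr k (symb (T i j))" by (auto elim: AlgE)
  qed
  have "sym_bound (words k) n (\<lambda>i j. symb (T i j)) c"
    using mat mat_bound_iff_sym_bound[of n k "\<lambda>i j. symb (T i j)" T c] * by blast
  then have "sym_bound (words k') n (\<lambda>i j. F (symb (T i j))) (C * c)"
    by (intro cb c) (use *(1) in \<open>auto simp: alg_sym_def\<close>)
  then show "mat_bound k' n (\<lambda>i j. \<Phi> (T i j)) (C * c)"
    by (subst mat_bound_iff_sym_bound[where a = "\<lambda>i j. F (symb (T i j))"])
      (auto simp: \<Phi>_def intro: alg_sym_F *(1))
qed

end

lemma completely_isomorphicI:
  assumes F: "symbol_map k k' F C" and G: "symbol_map k' k G D"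
    and GF: "\<And>a. supp_in k a \<Longrightarrow> G (F a) = a" and FG: "\<And>a. supp_in k' a \<Longrightarrow> F (G a) = a"
  shows "completely_isomorphic k k'"
proof -
  interpret F: symbol_map k k' F C by fact
  interpret G: symbol_map k' k G D by fact
  have "G.\<Phi> (F.\<Phi> T) = T" if "T \<in> Alg k" for T
    using that by (elim AlgE) (simp add: F.\<Phi>_def G.\<Phi>_def GF alg_sym_def)
  moreover have "F.\<Phi> (G.\<Phi> T) = T" if "T \<in> Alg k'" for T
    using that by (elim AlgE) (simp add: F.\<Phi>_def G.\<Phi>_def FG alg_sym_def)
  ultimately show ?thesis
    unfolding completely_isomorphic_def
    by (intro exI[of _ F.\<Phi>] exI[of _ G.\<Phi>])
      (auto simp: F.Phi_Alg G.Phi_Alg F.lin_on_Phi F.cb_on_Phi G.cb_on_Phi)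
qed

theorem theorem10:
  fixes k :: nat
  assumes "k \<ge> 2"
  shows "completely_isomorphic (enat k) \<infinity>"
proof -
  have k: "2 \<le> enat k" using assms by (simp add: numeral_eq_enat)
  note sr = sigma_rho[OF k] and rs = rho_sigma[OF k] and sw = sigma_in_words[OF k]
  obtain C where C: "0 \<le> C" "\<And>n a c. 0 \<le> c \<Longrightarrow> sym_bound UNIV n a c \<Longrightarrow>
      sym_bound UNIV n (\<lambda>i j. bwd_op (enat k) (a i j)) (C * c)"
    using cb_sym_bwd_op[of "enat k"] unfolding cb_sym_def by blast
  obtain D where D: "0 \<le> D" "\<And>n a c. 0 \<le> c \<Longrightarrow> sym_bound UNIV n a c \<Longrightarrow>
      sym_bound UNIV n (\<lambda>i j. fwd (enat k) (a i j)) (D * c)"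
    using cb_sym_fwd[OF k] unfolding cb_sym_def by blast
  have "symbol_map (enat k) \<infinity> (bwd (enat k)) C"
  proof
    fix n a and c :: real
    assume c: "0 \<le> c" and supp: "\<And>i j. i < n \<Longrightarrow> j < n \<Longrightarrow> supp_in (enat k) (a i j)"
      and a: "sym_bound (words (enat k)) n a c"
    \<comment> \<open>\<open>bwd_op\<close> is controlled on bounds over all words, so the given
      bound over \<open>words k\<close> is first extended.\<close>
    have "sym_bound UNIV n a c"
      by (rule sym_bound_words_UNIV[OF a]) (use supp in \<open>auto simp: supp_in_def\<close>)
    from C(2)[OF c this] have "sym_bound UNIV n (\<lambda>i j. bwd (enat k) (a i j)) (C * c)"
    proof (rule sym_bound_cong)
      show "bwd_op (enat k) (a i j) = bwd (enat k) (a i j)" if "i < n" "j < n" for i j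
        using bwd_eq[OF k, of "a i j"] supp[OF that] by (simp add: fun_eq_iff supp_in_def)
    qed
    then show "sym_bound (words \<infinity>) n (\<lambda>i j. bwd (enat k) (a i j)) (C * c)" by simp
  next
    fix s assume "poly_sym (enat k) s"
    \<comment> \<open>The support of the image is a preimage under \<open>\<sigma>\<close>, finite
      by injectivity.\<close>
    moreover have "inj (\<sigma> (enat k))" by (rule injI) (metis rs)
    ultimately have "finite (\<sigma> (enat k) -` {w. s w \<noteq> 0})"
      by (intro finite_vimageI) (simp_all add: poly_sym_def)
    then show "poly_sym \<infinity> (bwd (enat k) s)"
      by (simp add: poly_sym_def bwd_def supp_in_def vimage_def)
  qed (simp_all add: C(1) bwd_def[abs_def] supp_in_def)
  moreover have "symbol_map \<infinity> (enat k) (fwd (enat k)) D"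
  proof
    fix n a and c :: real
    assume c: "0 \<le> c" and a: "sym_bound (words \<infinity>) n a c"
    show "sym_bound (words (enat k)) n (\<lambda>i j. fwd (enat k) (a i j)) (D * c)"
      by (rule sym_bound_subset[OF D(2)[OF c]]) (use a in simp_all)
  next
    fix s assume s: "poly_sym \<infinity> s"
    have "{x. fwd (enat k) s x \<noteq> 0} \<subseteq> \<sigma> (enat k) ` {w. s w \<noteq> 0}"
    proof
      fix x assume "x \<in> {x. fwd (enat k) s x \<noteq> 0}"
      then have "x \<in> words (enat k)" "s (\<rho> (enat k) x) \<noteq> 0"
        by (auto simp: fwd_def split: if_splits)
      then show "x \<in> \<sigma> (enat k) ` {w. s w \<noteq> 0}" by (intro image_eqI[of _ _ "\<rho> (enat k) x"]) (simp_all add: sr)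
    qed
    moreover have "finite (\<sigma> (enat k) ` {w. s w \<noteq> 0})" using s by (simp add: poly_sym_def)
    ultimately have "finite {x. fwd (enat k) s x \<noteq> 0}" by (rule finite_subset)
    then show "poly_sym (enat k) (fwd (enat k) s)"
      by (simp add: poly_sym_def) (simp add: supp_in_def fwd_def)
  qed (auto simp: D(1) fwd_def[abs_def] supp_in_def)
  ultimately show ?thesis
    by (rule completely_isomorphicI)
      (auto simp: fwd_def bwd_def fun_eq_iff supp_in_def sr rs sw)
qed

end
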